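(* Let $p\in(0,1)$ and let $\mathcal{G}_p$ be the class of monotonically decreasing functions $g:[0,1]\to[0,1]$ whose graph is symmetric about the line $y=x$ (in the sense made precise in the context) and for which the region $\Omega_g=\{(x,y)\in[0,1]^2: y\le g(x)\}$ has area $p$. Suppose $g\in\mathcal{G}_p$ is optimal, i.e. $g$ minimizes over $\mathcal{G}_p$ the expected squared $\mathcal{L}_2$-discrepancy $\mathbb{E}\,\mathcal{L}_2^2(\{p_1,p_2\})$, where $p_1$ and $p_2$ are independent random points, $p_1$ uniformly distributed on $\Omega_g$ and $p_2$ uniformly distributed on $[0,1]^2\setminus\Omega_g$. Then for $0\le x\le g^{-1}(0)$ (at every such $x$ at which $g$ is differentiable), \begin{align*} &\left(1-2p-4xg(x)\right)\left(1-g(x)\right)+(4p-1)\,x\left(1-g(x)^2\right)-4\int_{g(x)}^{g^{-1}(0)}(1-y)\,g(y)\,dy\\ &\quad+g'(x)\left(\left(1-2p-4xg(x)\right)(1-x)+(4p-1)\,g(x)\left(1-x^2\right)-4\int_{x}^{g^{-1}(0)}(1-y)\,g(y)\,dy\right)=0. \end{align*}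
   Context: For a set $P=\{p_1,\dots,p_N\}$ of $N$ points in $[0,1]^2$, the squared $\mathcal{L}_2$-discrepancy is $$\mathcal{L}_2^2(P)=\int_{[0,1]^2}\left|\frac{\#\left(P\cap([0,x]\times[0,y])\right)}{\#P}-xy\right|^2dx\,dy .$$ Convention on symmetry: the curve $y=g(x)$ meets the $x$-axis at a point $(a,0)$ with $a\in(0,1]$, denoted $a=g^{-1}(0)$. The graph of $g$ over $[0,a]$ is symmetric about the line $y=x$, i.e. $g$ restricted to $[0,a]$ is a decreasing bijection of $[0,a]$ onto itself that equals its own inverse ($g=g^{-1}$ on $[0,a]$, so $g(0)=a$ and $g(a)=0$), and $g(x)=0$ for $a\le x\le 1$. A monotone function is differentiable almost everywhere. *)

theory Defs
  imports "HOL-Probability.Probability"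
begin

definition unit_square :: "(real \<times> real) set" where
  "unit_square = {0..1} \<times> {0..1}"

definition sq_L2_discrepancy :: "(real \<times> real) set \<Rightarrow> real" where
  "sq_L2_discrepancy P =
     (LINT z:unit_square|lborel.
        \<bar>real (card (P \<inter> ({0..fst z} \<times> {0..snd z}))) / real (card P) - fst z * snd z\<bar>\<^sup>2)"

text \<open>Functions on the unit interval are represented by total functions of which only the
  values on \<open>{0..1}\<close> matter. The parameter \<open>a\<close> is the point written \<open>g\<^sup>-\<^sup>1(0)\<close> informally;
  it is determined by \<open>g\<close>, see \<open>symmetric_graph_unique\<close>.\<close>

definition symmetric_graph :: "(real \<Rightarrow> real) \<Rightarrow> real \<Rightarrow> bool" where
  "symmetric_graph g a \<longleftrightarrow>
     0 < a \<and> a \<le> 1 \<and>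
     bij_betw g {0..a} {0..a} \<and>
     (\<forall>x\<in>{0..a}. g (g x) = x) \<and>
     g 0 = a \<and> g a = 0 \<and>
     (\<forall>x\<in>{a..1}. g x = 0)"

lemma symmetric_graph_unique:
  assumes "symmetric_graph g a" "symmetric_graph g b"
  shows "a = b"
  using assms by (simp add: symmetric_graph_def)

definition region :: "(real \<Rightarrow> real) \<Rightarrow> (real \<times> real) set" where
  "region g = {z \<in> unit_square. snd z \<le> g (fst z)}"

definition admissible :: "real \<Rightarrow> (real \<Rightarrow> real) set" where
  "admissible p =
     {g. g ` {0..1} \<subseteq> {0..1} \<and> antimono_on {0..1} g \<and> (\<exists>a. symmetric_graph g a) \<and>
         measure lborel (region g) = p}"

text \<open>Independence of the two points is expressed by the product of their distributions.\<close>

definition expected_sq_L2_discrepancy :: "(real \<Rightarrow> real) \<Rightarrow> real" where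
  "expected_sq_L2_discrepancy g =
     (LINT z|(uniform_measure lborel (region g) \<Otimes>\<^sub>M
              uniform_measure lborel (unit_square - region g)).
        sq_L2_discrepancy {fst z, snd z})"

definition optimal :: "real \<Rightarrow> (real \<Rightarrow> real) \<Rightarrow> bool" where
  "optimal p g \<longleftrightarrow>
     g \<in> admissible p \<and>
     (\<forall>h\<in>admissible p. expected_sq_L2_discrepancy g \<le> expected_sq_L2_discrepancy h)"

end

theory Submission
  imports Defs
begin

text \<open>Write $A_g(x,y)$ for the area of $\Omega_g\cap([0,x]\times[0,y])$. Up to terms independent of
  $g$, the expected discrepancy is the integral over the unit square of a polynomial of degree two
  in $A_g$ whose quadratic term is $-A_g^2/(2p(1-p))$. By this concavity, an optimal $g$ also
  minimises the linear functional $h\mapsto\int_{\Omega_h}K$ over the admissible $h$, where the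
  kernel $K$ is the first variation at $g$. If $K(x,g(x))$ were not constant, then a small area
  could be moved from a place on the curve where $K$ is large to one where it is small, keeping the
  curve monotone and symmetric. So $K(x,g(x))$ is constant, and differentiating it by the chain rule
  gives the claimed equation.\<close>

section \<open>Symmetric decreasing curves\<close>

text \<open>Beyond continuity no regularity of g is available, so adding a bump to g could destroy
  its monotonicity. The curve is therefore moved by reparametrisation: for a strictly increasing map
  \<psi> of [0,c] fixing both ends, the composition of g with \<psi> is again continuous and
  strictly decreasing, and it lies above or below g according as \<psi> lies below or above the
  identity. Only the half over [0,c] is perturbed, where c is the fixed point of g; the other half
  is obtained by reflection, which makes the new curve symmetric by construction. The area is an
  affine function of the half over [0,c], so a convex combination of a raised and a lowered half,
  with suitable weights, has area exactly p. A single such competitor suffices, and no limit in a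
  perturbation parameter is taken.

  The chain rule can be used at any single point of differentiability of g because K itself is
  differentiable on the closed square: it is the integral of a continuous density over the upper
  right corner, whatever the smoothness of g.\<close>

locale symmetric_curve =
  fixes g :: "real \<Rightarrow> real" and a :: real
  assumes sym: "symmetric_graph g a"
    and anti: "antimono_on {0..1} g"
begin

lemma a_pos: "0 < a" and a_le_1: "a \<le> 1" and g_0: "g 0 = a" and g_a: "g a = 0"
  using sym by (auto simp: symmetric_graph_def)

lemma g_g: "x \<in> {0..a} \<Longrightarrow> g (g x) = x"
  using sym unfolding symmetric_graph_def by blast

lemma g_mem: "x \<in> {0..a} \<Longrightarrow> g x \<in> {0..a}"
  using sym bij_betw_apply unfolding symmetric_graph_def by metis

lemma g_beyond: "x \<in> {a..1} \<Longrightarrow> g x = 0"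
  using sym unfolding symmetric_graph_def by blast

lemma g_antimono: "0 \<le> x \<Longrightarrow> x \<le> y \<Longrightarrow> y \<le> 1 \<Longrightarrow> g y \<le> g x"
  using anti by (auto simp: monotone_on_def)

lemma g_strict:
  assumes "0 \<le> x" "x < y" "y \<le> a"
  shows "g y < g x"
proof -
  have "g y \<le> g x" using assms a_le_1 by (intro g_antimono) auto
  moreover have "g y \<noteq> g x" using g_g[of x] g_g[of y] assms by auto
  ultimately show ?thesis by simp
qed

lemma g_range:
  assumes "0 \<le> x" "x \<le> 1"
  shows "0 \<le> g x" "g x \<le> a"
proof -
  have "0 \<le> g x \<and> g x \<le> a"
  proof (cases "x \<le> a")
    case True
    then show ?thesis using g_mem[of x] assms by simp
  next
    case False
    then show ?thesis using g_beyond[of x] assms a_pos by simp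
  qed
  then show "0 \<le> g x" "g x \<le> a" by simp_all
qed

lemma g_le_1: "0 \<le> x \<Longrightarrow> x \<le> 1 \<Longrightarrow> g x \<le> 1"
  using g_range(2)[of x] a_le_1 by simp

text \<open>A decreasing involution has no jumps: for \<open>b\<close> in \<open>{0..a}\<close> the
  condition \<open>b < g t\<close> amounts to \<open>t < g b\<close>, so preimages of rays are
  relatively open rays. Values \<open>b\<close> outside \<open>{0..a}\<close> are settled by the
  range of \<open>g\<close>.\<close>

lemma g_continuous: "continuous_on {0..1} g"
proof -
  have "continuous_on {0..a} g"
    unfolding continuous_on_def
  proof (intro ballI order_tendstoI)
    fix x b assume x: "x \<in> {0..a}" and b: "b < g x"
    show "\<forall>\<^sub>F t in at x within {0..a}. b < g t"
    proof (cases "b < 0")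
      case True
      then have "\<And>t. t \<in> {0..a} \<Longrightarrow> b < g t" using g_mem by force
      then show ?thesis by (simp add: eventually_at_filter)
    next
      case False
      have "x < g b"
        using g_strict[of b "g x"] g_mem[OF x] g_g[OF x] b False by auto
      then have "\<forall>\<^sub>F t in at x within {0..a}. t < g b"
        by (rule order_tendstoD[OF tendsto_ident_at])
      moreover have "\<forall>\<^sub>F t in at x within {0..a}. t \<in> {0..a}"
        by (simp add: eventually_at_filter)
      ultimately show ?thesis
      proof eventually_elim
        case (elim t)
        have "b \<in> {0..a}" using b False g_mem[OF x] by auto
        then show ?case using g_strict[of t "g b"] g_g[of b] elim g_mem[of b] by simp
      qed
    qed
  next
    fix x b assume x: "x \<in> {0..a}" and b: "g x < b"
    show "\<forall>\<^sub>F t in at x within {0..a}. g t < b"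
    proof (cases "b > a")
      case True
      then have "\<And>t. t \<in> {0..a} \<Longrightarrow> g t < b" using g_mem by force
      then show ?thesis by (simp add: eventually_at_filter)
    next
      case False
      have "g b < x"
        using g_strict[of "g x" b] g_mem[OF x] g_g[OF x] b False by auto
      then have "\<forall>\<^sub>F t in at x within {0..a}. g b < t"
        by (rule order_tendstoD[OF tendsto_ident_at])
      moreover have "\<forall>\<^sub>F t in at x within {0..a}. t \<in> {0..a}"
        by (simp add: eventually_at_filter)
      ultimately show ?thesis
      proof eventually_elim
        case (elim t)
        have "b \<in> {0..a}" using b False g_mem[OF x] by auto
        then show ?case using g_strict[of "g b" t] g_g[of b] elim g_mem[of b] by simp
      qed
    qed
  qed
  moreover have "continuous_on {a..1} g"
    using g_beyond by (subst continuous_on_cong[OF refl, of _ _ "\<lambda>_. 0"]) auto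
  ultimately have "continuous_on ({0..a} \<union> {a..1}) g"
    by (intro continuous_on_closed_Un) simp_all
  then show ?thesis
    unfolding ivl_disj_un_two_touch(4)[OF less_imp_le[OF a_pos] a_le_1] .
qed

text \<open>The symmetry of the region holds off the axes only: for \<open>a < x\<close> the point
  \<open>(x, 0)\<close> lies in the region, while its mirror image \<open>(0, x)\<close> lies above
  the graph.\<close>

lemma le_g_iff:
  assumes "0 < x" "x \<le> 1" "0 < y" "y \<le> 1"
  shows "y \<le> g x \<longleftrightarrow> x \<le> g y"
proof -
  have *: "u \<le> g v" if "0 < u" "u \<le> 1" "0 < v" "v \<le> 1" "v \<le> g u" for u v
  proof -
    have "u \<le> a"
    proof (rule ccontr)
      assume "\<not> u \<le> a"
      then have "g u = 0" using that by (intro g_beyond) simp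
      then show False using that by simp
    qed
    have "g (g u) \<le> g v" using that g_range[of u] a_le_1 by (intro g_antimono) simp_all
    then show ?thesis using g_g[of u] that(1) \<open>u \<le> a\<close> by simp
  qed
  show ?thesis
    using *[OF assms] *[OF assms(3,4,1,2)] by (rule iffI)
qed

lemma fixed_point:
  obtains c where "0 < c" "c < a" "g c = c"
proof -
  have "continuous_on {0..a} g"
    using a_le_1 by (intro continuous_on_subset[OF g_continuous]) auto
  then have "continuous_on {0..a} (\<lambda>x. x - g x)"
    by (intro continuous_intros)
  then have "\<exists>x. 0 \<le> x \<and> x \<le> a \<and> x - g x = 0"
    using IVT'[of "\<lambda>x. x - g x" 0 0 a] a_pos g_0 g_a by simp
  then obtain c where c: "0 \<le> c" "c \<le> a" "g c = c" by auto
  moreover have "c \<noteq> 0" "c \<noteq> a" using c g_0 g_a a_pos by auto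
  ultimately show thesis using that[of c] by linarith
qed

lemma region_compact: "compact (region g)"
proof -
  have "continuous_on unit_square (\<lambda>z. g (fst z))"
    unfolding unit_square_def
    by (rule continuous_on_compose2[OF g_continuous]) (auto intro: continuous_intros)
  then have "closed {z \<in> unit_square. snd z \<le> g (fst z)}"
    by (intro continuous_on_closed_Collect_le)
       (auto intro!: continuous_intros simp: unit_square_def closed_Times)
  then have "closed (region g)" unfolding region_def by simp
  moreover have "region g = unit_square \<inter> region g" by (auto simp: region_def)
  moreover have "compact unit_square" by (auto simp: unit_square_def intro: compact_Times)
  ultimately show ?thesis using compact_Int_closed[of unit_square "region g"] by simp
qed

end

section \<open>Areas cut out of the region by boxes at the origin\<close>

definition corner_area :: "(real \<Rightarrow> real) \<Rightarrow> real \<Rightarrow> real \<Rightarrow> real" where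
  "corner_area g x y = measure lborel (region g \<inter> ({0..x} \<times> {0..y}))"

lemma measure_unit_square: "measure lborel unit_square = 1" "emeasure lborel unit_square = 1"
proof -
  have "emeasure (lborel \<Otimes>\<^sub>M lborel) ({0..1::real} \<times> {0..1::real}) = 1"
    by (subst lborel.emeasure_pair_measure_Times) simp_all
  then have "emeasure lborel unit_square = 1" by (simp add: lborel_prod unit_square_def)
  then show "measure lborel unit_square = 1" "emeasure lborel unit_square = 1"
    by (auto simp: measure_def)
qed

lemma unit_square_borel [measurable]: "unit_square \<in> sets borel"
  unfolding unit_square_def by (intro borel_closed closed_Times) auto

lemma corner_area_bounds:
  assumes "region g \<in> sets borel"
  shows "0 \<le> corner_area g x y" "corner_area g x y \<le> 1"
proof -
  have "measure lborel (region g \<inter> ({0..x} \<times> {0..y})) \<le> measure lborel unit_square"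
    using assms measure_unit_square
    by (intro measure_mono_fmeasurable fmeasurableI sets.Int)
       (auto simp: region_def intro!: borel_closed closed_Times)
  then show "0 \<le> corner_area g x y" "corner_area g x y \<le> 1"
    by (simp_all add: corner_area_def measure_unit_square)
qed

lemma measure_region_eq: "measure lborel (region g) = corner_area g 1 1"
proof -
  have "region g \<inter> ({0..1} \<times> {0..1}) = region g" by (auto simp: region_def unit_square_def)
  then show ?thesis by (simp add: corner_area_def)
qed

text \<open>The axes, where the reflection of the region may fail, form a null set.\<close>

lemma AE_lborel_coordinates_nonzero:
  "AE z in lborel. (fst z :: real) \<noteq> 0 \<and> (snd z :: real) \<noteq> 0"
proof -
  have "AE z in lborel \<Otimes>\<^sub>M lborel. (fst z :: real) \<noteq> 0 \<and> (snd z :: real) \<noteq> 0"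
  proof (rule lborel_pair.AE_pair_measure)
    have "AE x in lborel. x \<noteq> (0::real)" by (rule AE_lborel_singleton)
    then show "AE x in lborel. AE y in lborel. fst (x, y) \<noteq> (0::real) \<and> snd (x, y) \<noteq> (0::real)"
    proof eventually_elim
      case (elim x)
      then show ?case by (simp add: AE_lborel_singleton)
    qed
  qed measurable
  then show ?thesis unfolding lborel_prod .
qed

context symmetric_curve
begin

lemma region_borel [measurable]: "region g \<in> sets borel"
  using region_compact by (intro borel_compact)

lemma region_box_borel: "region g \<inter> ({0..x} \<times> {0..y}) \<in> sets borel"
  by (intro sets.Int region_borel borel_closed closed_Times closed_atLeastAtMost)

lemma g_integrable: "0 \<le> x \<Longrightarrow> y \<le> 1 \<Longrightarrow> g integrable_on {x..y}"
  by (intro integrable_continuous_real continuous_on_subset[OF g_continuous]) simp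

lemma min_g_continuous: "0 \<le> x \<Longrightarrow> y \<le> 1 \<Longrightarrow> continuous_on {x..y} (\<lambda>s. min c (g s))"
  by (intro continuous_intros continuous_on_subset[OF g_continuous]) simp

lemma corner_area_eq_integral:
  assumes "0 \<le> x" "x \<le> 1" "0 \<le> y" "y \<le> 1"
  shows "corner_area g x y = integral {0..x} (\<lambda>s. min y (g s))"
proof -
  let ?X = "region g \<inter> ({0..x} \<times> {0..y})" and ?f = "\<lambda>s. min y (g s)"
  have X: "?X \<in> sets (lborel \<Otimes>\<^sub>M lborel)"
    unfolding lborel_prod by (simp add: region_box_borel)
  have int: "set_integrable lborel {0..x} ?f"
    using assms by (intro borel_integrable_atLeastAtMost' min_g_continuous) simp_all
  have nonneg: "0 \<le> indicator {0..x} s *\<^sub>R ?f s" for s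
    using g_range(1)[of s] assms by (auto simp: indicator_def)
  have slice: "emeasure lborel (Pair s -` ?X) = ennreal (indicator {0..x} s *\<^sub>R ?f s)" for s
  proof (cases "s \<in> {0..x}")
    case True
    then have "Pair s -` ?X = {0..?f s}"
      using assms by (auto simp: region_def unit_square_def)
    then show ?thesis using True g_range(1)[of s] assms by (simp add: indicator_def)
  qed auto
  have "emeasure lborel ?X = emeasure (lborel \<Otimes>\<^sub>M lborel) ?X" by (simp add: lborel_prod)
  also have "\<dots> = (\<integral>\<^sup>+s. ennreal (indicator {0..x} s *\<^sub>R ?f s) \<partial>lborel)"
    using X by (subst lborel.emeasure_pair_measure_alt) (simp_all only: slice)
  also have "\<dots> = ennreal (LINT s:{0..x}|lborel. ?f s)"
    using int nonneg unfolding set_integrable_def set_lebesgue_integral_def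
    by (intro nn_integral_eq_integral) simp_all
  also have "\<dots> = ennreal (integral {0..x} ?f)"
    by (simp only: set_borel_integral_eq_integral(2)[OF int])
  finally have "emeasure lborel ?X = ennreal (integral {0..x} ?f)" .
  moreover have "0 \<le> integral {0..x} ?f"
    using assms g_range(1)
    by (intro integral_nonneg integrable_continuous_real min_g_continuous) simp_all
  ultimately show ?thesis by (simp add: corner_area_def measure_def)
qed

text \<open>Reflection in the diagonal preserves Lebesgue measure and maps the region to itself up
  to the axes.\<close>

lemma corner_area_commute:
  assumes "0 \<le> x" "x \<le> 1" "0 \<le> y" "y \<le> 1"
  shows "corner_area g x y = corner_area g y x"
proof -
  let ?X = "\<lambda>x y. region g \<inter> ({0..x} \<times> {0..y})"
  let ?s = "\<lambda>(x::real, y::real). (y, x)"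
  have X: "?X x y \<in> sets borel" for x y
    by (rule region_box_borel)
  note ae = AE_lborel_coordinates_nonzero
  have "emeasure lborel (?X y x) = emeasure (lborel \<Otimes>\<^sub>M lborel) (?X y x)"
    by (simp add: lborel_prod)
  also have "\<dots> = emeasure (distr (lborel \<Otimes>\<^sub>M lborel) (lborel \<Otimes>\<^sub>M lborel) ?s) (?X y x)"
    by (simp flip: lborel_pair.distr_pair_swap)
  also have "\<dots> = emeasure (lborel \<Otimes>\<^sub>M lborel) (?s -` ?X y x \<inter> space (lborel \<Otimes>\<^sub>M lborel))"
    using X by (intro emeasure_distr measurable_pair_swap') (simp only: lborel_prod sets_lborel)
  also have "\<dots> = emeasure lborel (?s -` ?X y x)"
    by (simp add: lborel_prod)
  also have "\<dots> = emeasure lborel (?X x y)"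
  proof (rule emeasure_eq_AE)
    show "AE z in lborel. z \<in> ?s -` ?X y x \<longleftrightarrow> z \<in> ?X x y"
      using ae
    proof eventually_elim
      case (elim z)
      then show ?case
        using le_g_iff[of "fst z" "snd z"]
        by (cases z) (auto simp: region_def unit_square_def)
    qed
    have "?s \<in> borel \<rightarrow>\<^sub>M borel" by (simp add: borel_prod[symmetric])
    then show "?s -` ?X y x \<in> sets lborel"
      using measurable_sets[OF _ X, of ?s borel y x] by simp
  qed (use X in simp)
  finally show ?thesis by (simp add: corner_area_def measure_def)
qed

text \<open>A change of \<open>y\<close> alters the integrand \<open>min y (g s)\<close> by at most
  that change; a change of \<open>x\<close> is reduced to this case by symmetry.\<close>

lemma corner_area_lipschitz:
  assumes "0 \<le> x" "x \<le> 1" "0 \<le> y" "y \<le> 1" "0 \<le> x'" "x' \<le> 1" "0 \<le> y'" "y' \<le> 1"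
  shows "\<bar>corner_area g x y - corner_area g x' y'\<bar> \<le> \<bar>x - x'\<bar> + \<bar>y - y'\<bar>"
proof -
  have *: "\<bar>corner_area g x y - corner_area g x y'\<bar> \<le> \<bar>y - y'\<bar>"
    if "0 \<le> x" "x \<le> 1" "0 \<le> y" "y \<le> 1" "0 \<le> y'" "y' \<le> 1" for x y y'
  proof -
    have i: "(\<lambda>s. min c (g s)) integrable_on {0..x}" for c
      using that by (intro integrable_continuous_real min_g_continuous) simp_all
    have "corner_area g x y - corner_area g x y' = integral {0..x} (\<lambda>s. min y (g s) - min y' (g s))"
      using that by (simp add: corner_area_eq_integral integral_diff i)
    also have "norm \<dots> \<le> integral {0..x} (\<lambda>s. \<bar>y - y'\<bar>)"
      by (intro integral_norm_bound_integral integrable_diff i integrable_const_ivl)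
         (auto simp: min_def)
    also have "\<dots> \<le> 1 * \<bar>y - y'\<bar>" using that by (simp add: mult_left_le_one_le)
    finally show ?thesis by simp
  qed
  have "\<bar>corner_area g x y - corner_area g x y'\<bar> \<le> \<bar>y - y'\<bar>" using assms by (intro *)
  moreover have "\<bar>corner_area g y' x - corner_area g y' x'\<bar> \<le> \<bar>x - x'\<bar>" using assms by (intro *)
  moreover have "corner_area g y' x = corner_area g x y'" "corner_area g y' x' = corner_area g x' y'"
    using assms by (intro corner_area_commute; simp)+
  ultimately show ?thesis by linarith
qed

lemma corner_area_continuous:
  "continuous_on unit_square (\<lambda>z. corner_area g (fst z) (snd z))"
proof (rule lipschitz_on_continuous_on, rule lipschitz_onI)
  fix z w assume zw: "z \<in> unit_square" "w \<in> unit_square"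
  have "\<bar>corner_area g (fst z) (snd z) - corner_area g (fst w) (snd w)\<bar>
      \<le> dist (fst z) (fst w) + dist (snd z) (snd w)"
    using zw unfolding dist_real_def unit_square_def by (intro corner_area_lipschitz) auto
  also have "\<dots> \<le> 2 * dist z w"
    using dist_fst_le[of z w] dist_snd_le[of z w] by simp
  finally show "dist (corner_area g (fst z) (snd z)) (corner_area g (fst w) (snd w)) \<le> 2 * dist z w"
    by (simp add: dist_real_def)
qed simp

text \<open>The region is its part over \<open>{0..c}\<close> together with the mirror image of that
  part, and the two overlap in the square of side \<open>c\<close>. The area constraint thus becomes
  affine in the half of the curve over \<open>{0..c}\<close>.\<close>

lemma measure_region_fixed_point:
  assumes "0 < c" "c < a" "g c = c"
  shows "measure lborel (region g) = 2 * integral {0..c} g - c\<^sup>2"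
proof -
  have c: "0 \<le> c" "c \<le> 1" using assms a_le_1 by simp_all
  have min_1: "integral {0..x} (\<lambda>s. min 1 (g s)) = integral {0..x} g" if "x \<le> 1" for x
  proof (rule integral_cong)
    fix s assume "s \<in> {0..x}"
    then have "g s \<le> 1" using g_range(2)[of s] a_le_1 that by simp
    then show "min 1 (g s) = g s" by (rule min_absorb2)
  qed
  have eq: "corner_area g 1 1 = integral {0..1} g"
    using min_1[of 1] corner_area_eq_integral[of 1 1] by simp
  have "integral {0..c} g = corner_area g c 1"
    using min_1[of c] corner_area_eq_integral[of c 1] c by simp
  also have "\<dots> = corner_area g 1 c" using c by (intro corner_area_commute) simp_all
  also have "\<dots> = integral {0..1} (\<lambda>s. min c (g s))" using c by (intro corner_area_eq_integral) simp_all
  also have "\<dots> = integral {0..c} (\<lambda>s. min c (g s)) + integral {c..1} (\<lambda>s. min c (g s))"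
    using c by (intro Henstock_Kurzweil_Integration.integral_combine[symmetric]
        integrable_continuous_real min_g_continuous) simp_all
  also have "integral {0..c} (\<lambda>s. min c (g s)) = integral {0..c} (\<lambda>s. c)"
    using g_antimono[of _ c] c assms(3) by (intro integral_cong) (simp add: min_def)
  also have "\<dots> = c\<^sup>2" using c by (simp add: power2_eq_square)
  also have "integral {c..1} (\<lambda>s. min c (g s)) = integral {c..1} g"
    using g_antimono[of c] c assms(3) by (intro integral_cong) (simp add: min_absorb2)
  finally have "integral {0..c} g = c\<^sup>2 + integral {c..1} g" .
  moreover have "integral {0..1} g = integral {0..c} g + integral {c..1} g"
    using c by (intro Henstock_Kurzweil_Integration.integral_combine[symmetric] g_integrable) simp_all
  ultimately show ?thesis by (simp add: measure_region_eq eq)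
qed

text \<open>For \<open>y\<close> at least \<open>g u\<close>, the corner area is a full rectangle of
  area \<open>u * g u\<close> plus the area under \<open>g\<close> from \<open>g u\<close> to
  \<open>y\<close>. Integrating the latter by parts produces the weight \<open>1 - t\<close> of the
  final equation.\<close>

lemma integral_corner_area:
  assumes "u \<in> {0..a}"
  shows "integral {g u..1} (corner_area g u) = u * g u * (1 - g u) + integral {g u..a} (\<lambda>t. (1 - t) * g t)"
proof -
  define v where "v = g u"
  have v: "v \<in> {0..a}" "g v = u" using assms g_mem g_g by (simp_all add: v_def)
  have u: "0 \<le> u" "u \<le> 1" "v \<le> 1" using assms a_le_1 v by simp_all
  define G where "G = (\<lambda>y. integral {v..y} g)"
  have cont: "continuous_on {v..1} g"
    using v by (intro continuous_on_subset[OF g_continuous]) simp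
  have G: "(G has_real_derivative g y) (at y within {v..1})" if "y \<in> {v..1}" for y
    unfolding G_def using cont that by (rule integral_has_real_derivative)
  have A: "corner_area g u y = u * v + G y" if y: "y \<in> {v..1}" for y
  proof -
    have "corner_area g u y = corner_area g y u"
      using y u v by (intro corner_area_commute) simp_all
    also have "\<dots> = integral {0..y} (\<lambda>t. min u (g t))"
      using y u v by (intro corner_area_eq_integral) simp_all
    also have "\<dots> = integral {0..v} (\<lambda>t. min u (g t)) + integral {v..y} (\<lambda>t. min u (g t))"
      using y u v by (intro Henstock_Kurzweil_Integration.integral_combine[symmetric]
        integrable_continuous_real min_g_continuous) simp_all
    also have "integral {0..v} (\<lambda>t. min u (g t)) = integral {0..v} (\<lambda>t. u)"
      using g_antimono[of _ v] u v by (intro integral_cong) (simp add: min_def)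
    also have "\<dots> = u * v" using v by simp
    also have "integral {v..y} (\<lambda>t. min u (g t)) = G y"
      unfolding G_def using g_antimono[of v] u v y by (intro integral_cong) (simp add: min_absorb2)
    finally show ?thesis .
  qed
  \<comment> \<open>Integration by parts: \<open>- (1 - y) * G y\<close> vanishes at
    \<open>1\<close> by its first factor and at \<open>v\<close> because
    \<open>G v = 0\<close>.\<close>
  have "((\<lambda>y. G y - (1 - y) * g y) has_integral (- (1 - 1) * G 1 - - (1 - v) * G v)) {v..1}"
  proof (rule fundamental_theorem_of_calculus)
    fix y assume "y \<in> {v..1}"
    then show "((\<lambda>y. - (1 - y) * G y) has_vector_derivative G y - (1 - y) * g y) (at y within {v..1})"
      unfolding has_real_derivative_iff_has_vector_derivative[symmetric]
      by (auto intro!: derivative_eq_intros G simp: algebra_simps)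
  qed (use u in simp)
  moreover have "G v = 0" by (simp add: G_def)
  ultimately have 1: "((\<lambda>y. G y - (1 - y) * g y) has_integral 0) {v..1}" by simp
  have "(\<lambda>y. (1 - y) * g y) integrable_on {v..1}"
    using cont by (intro integrable_continuous_real continuous_intros)
  from has_integral_add[OF 1 integrable_integral[OF this]]
  have "(G has_integral integral {v..1} (\<lambda>y. (1 - y) * g y)) {v..1}" by simp
  from has_integral_add[OF has_integral_const_real[of "u * v" v 1] this]
  have "((\<lambda>y. u * v + G y) has_integral u * v * (1 - v) + integral {v..1} (\<lambda>y. (1 - y) * g y)) {v..1}"
    using u by (simp add: mult.commute)
  then have "integral {v..1} (\<lambda>y. u * v + G y) = u * v * (1 - v) + integral {v..1} (\<lambda>y. (1 - y) * g y)"
    by (rule integral_unique)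
  moreover have "integral {v..1} (corner_area g u) = integral {v..1} (\<lambda>y. u * v + G y)"
    by (intro integral_cong A)
  moreover have "integral {v..1} (\<lambda>y. (1 - y) * g y)
      = integral {v..a} (\<lambda>y. (1 - y) * g y) + integral {a..1} (\<lambda>y. (1 - y) * g y)"
    using v a_le_1 cont by (intro Henstock_Kurzweil_Integration.integral_combine[symmetric]
        integrable_continuous_real continuous_intros) simp_all
  moreover have "integral {a..1} (\<lambda>y. (1 - y) * g y) = integral {a..1} (\<lambda>y. 0)"
    by (intro integral_cong) (simp add: g_beyond)
  ultimately show ?thesis by (simp add: v_def)
qed

end

section \<open>Integrals of continuous functions over the upper right corners of the square\<close>

text \<open>An iterated gauge integral, so that the fundamental theorem of calculus applies directly
  to the limits \<open>u\<close> and \<open>v\<close>.\<close>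

definition corner_integral :: "(real \<times> real \<Rightarrow> real) \<Rightarrow> real \<Rightarrow> real \<Rightarrow> real" where
  "corner_integral B u v = integral {u..1} (\<lambda>x. integral {v..1} (\<lambda>y. B (x, y)))"

context
  fixes B :: "real \<times> real \<Rightarrow> real"
  assumes B: "continuous_on unit_square B"
begin

lemma corner_integral_continuous_snd:
  assumes "0 \<le> u"
  shows "continuous_on {0..1} (\<lambda>v. integral {u..1} (\<lambda>x. B (x, v)))"
proof -
  have "continuous_on ({0..1} \<times> cbox u 1) (\<lambda>(v, x). B (x, v))"
    unfolding split_beta
    by (rule continuous_on_compose2[OF B]) (use assms in \<open>auto simp: unit_square_def intro!: continuous_intros\<close>)
  from integral_continuous_on_param[OF this] show ?thesis by simp
qed

lemma corner_integral_continuous_fst: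
  assumes "0 \<le> v"
  shows "continuous_on {0..1} (\<lambda>u. integral {v..1} (\<lambda>y. B (u, y)))"
proof -
  have "continuous_on ({0..1} \<times> cbox v 1) (\<lambda>(u, y). B (u, y))"
    unfolding split_beta
    by (rule continuous_on_compose2[OF B]) (use assms in \<open>auto simp: unit_square_def intro!: continuous_intros\<close>)
  from integral_continuous_on_param[OF this] show ?thesis by simp
qed

lemma corner_integral_swap:
  assumes "0 \<le> u" "0 \<le> v"
  shows "corner_integral B u v = integral {v..1} (\<lambda>y. integral {u..1} (\<lambda>x. B (x, y)))"
proof -
  have "continuous_on (cbox (u, v) (1, 1)) (\<lambda>(x, y). B (x, y))"
    unfolding split_beta
    by (rule continuous_on_compose2[OF B]) (use assms in \<open>auto simp: unit_square_def intro!: continuous_intros\<close>)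
  from integral_swap_continuous[OF this] show ?thesis
    by (simp add: corner_integral_def)
qed

lemma corner_integral_eq_lebesgue:
  assumes "0 \<le> u" "0 \<le> v"
  shows "corner_integral B u v = (LINT z:{u..1} \<times> {v..1}|lborel. B z)"
proof -
  have sq: "cbox (u, v) (1, 1) = {u..1} \<times> {v..1}" by auto
  have cont: "continuous_on ({u..1} \<times> {v..1}) B"
    by (rule continuous_on_subset[OF B]) (use assms in \<open>auto simp: unit_square_def\<close>)
  then have "set_integrable lborel ({u..1} \<times> {v..1}) B"
    unfolding set_integrable_def by (intro borel_integrable_compact compact_Times) simp_all
  then have "(LINT z:{u..1} \<times> {v..1}|lborel. B z) = integral ({u..1} \<times> {v..1}) B"
    by (rule set_borel_integral_eq_integral(2))
  then show ?thesis
    using integral_prod_continuous[of u v 1 1 B] cont unfolding sq by (simp add: corner_integral_def)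
qed

lemma corner_integral_fst_derivative:
  assumes "u \<in> {0..1}" "0 \<le> v"
  shows "((\<lambda>u. corner_integral B u v) has_real_derivative - integral {v..1} (\<lambda>y. B (u, y)))
     (at u within {0..1})"
  unfolding corner_integral_def
  by (intro integral_has_real_derivative'[OF corner_integral_continuous_fst] assms)

lemma corner_integral_snd_derivative:
  assumes "0 \<le> u" "v \<in> {0..1}"
  shows "((\<lambda>v. corner_integral B u v) has_real_derivative - integral {u..1} (\<lambda>x. B (x, v)))
     (at v within {0..1})"
proof -
  have "((\<lambda>v. integral {v..1} (\<lambda>y. integral {u..1} (\<lambda>x. B (x, y)))) has_real_derivative
       - integral {u..1} (\<lambda>x. B (x, v))) (at v within {0..1})"
    using assms by (intro integral_has_real_derivative'[OF corner_integral_continuous_snd])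
  then show ?thesis
    unfolding has_field_derivative_def
    by (rule has_derivative_transform[rotated 2]) (use assms corner_integral_swap in simp_all)
qed

text \<open>Total differentiability follows from the two partial derivatives once one of them is
  jointly continuous. It is taken within the closed square because the curve reaches the boundary at
  \<open>(0, a)\<close> and \<open>(a, 0)\<close>.\<close>

lemma corner_integral_has_derivative:
  assumes "u \<in> {0..1}" "v \<in> {0..1}"
  shows "((\<lambda>(u, v). corner_integral B u v) has_derivative
     (\<lambda>(s, t). - integral {v..1} (\<lambda>y. B (u, y)) * s - integral {u..1} (\<lambda>x. B (x, v)) * t))
     (at (u, v) within {0..1} \<times> {0..1})"
proof -
  define D where "D = (\<lambda>u v. - integral {u..1} (\<lambda>x. B (x, v)))"
  \<comment> \<open>Writing \<open>max u x\<close> for \<open>x\<close> trades the moving limit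
    \<open>u\<close> for the fixed interval \<open>{0..1}\<close>, on which parameter integrals are
    continuous; the excess over \<open>{0..u}\<close> is \<open>u * B (u, v)\<close>.\<close>
  have eq: "D u v = u * B (u, v) - integral {0..1} (\<lambda>x. B (max u x, v))"
    if "u \<in> {0..1}" "v \<in> {0..1}" for u v
  proof -
    have "continuous_on {0..1} (\<lambda>x. B (max u x, v))"
      by (rule continuous_on_compose2[OF B])
        (use that in \<open>auto simp: unit_square_def intro!: continuous_intros\<close>)
    then have "integral {0..1} (\<lambda>x. B (max u x, v))
        = integral {0..u} (\<lambda>x. B (max u x, v)) + integral {u..1} (\<lambda>x. B (max u x, v))"
      using that by (intro Henstock_Kurzweil_Integration.integral_combine[symmetric]
          integrable_continuous_real) simp_all
    also have "integral {0..u} (\<lambda>x. B (max u x, v)) = integral {0..u} (\<lambda>x. B (u, v))"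
      by (intro integral_cong) (simp add: max_absorb1)
    also have "integral {u..1} (\<lambda>x. B (max u x, v)) = integral {u..1} (\<lambda>x. B (x, v))"
      by (intro integral_cong) (simp add: max_absorb2)
    finally show ?thesis using that by (simp add: D_def)
  qed
  have "continuous_on (({0..1} \<times> {0..1}) \<times> cbox 0 1) (\<lambda>(z, x). B (max (fst z) x, snd z))"
    unfolding split_beta
    by (rule continuous_on_compose2[OF B]) (auto simp: unit_square_def intro!: continuous_intros)
  from integral_continuous_on_param[OF this]
  have "continuous_on ({0..1} \<times> {0..1}) (\<lambda>z. integral {0..1} (\<lambda>x. B (max (fst z) x, snd z)))"
    by simp
  then have "continuous_on ({0..1} \<times> {0..1}) (\<lambda>z. fst z * B z - integral {0..1} (\<lambda>x. B (max (fst z) x, snd z)))"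
    using B by (intro continuous_intros) (simp_all add: unit_square_def)
  then have "continuous_on ({0..1} \<times> {0..1}) (\<lambda>z. D (fst z) (snd z))"
    by (rule continuous_on_eq) (auto simp: eq)
  then have "continuous_on ({0..1} \<times> {0..1}) (\<lambda>(u, v). blinfun_mult_right (D u v))"
    unfolding split_beta by (rule bounded_linear.continuous_on[OF bounded_linear_blinfun_mult_right])
  then have D: "continuous (at (u, v) within {0..1} \<times> {0..1}) (\<lambda>(u, v). blinfun_mult_right (D u v))"
    using assms by (simp add: continuous_on_eq_continuous_within)
  have "((\<lambda>(u, v). corner_integral B u v) has_derivative
     (\<lambda>(s, t). - integral {v..1} (\<lambda>y. B (u, y)) * s + blinfun_mult_right (D u v) t))
     (at (u, v) within {0..1} \<times> {0..1})"
  proof (intro has_derivative_partialsI D)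
    show "((\<lambda>u. corner_integral B u v) has_derivative
        (\<lambda>s. - integral {v..1} (\<lambda>y. B (u, y)) * s)) (at u within {0..1})"
      using assms by (intro has_field_derivative_imp_has_derivative corner_integral_fst_derivative) simp_all
  next
    fix u v :: real assume "u \<in> {0..1}" "v \<in> {0..1}"
    then show "(corner_integral B u has_derivative blinfun_mult_right (D u v)) (at v within {0..1})"
      using corner_integral_snd_derivative[of u v]
      by (simp add: has_field_derivative_def D_def blinfun_mult_right.rep_eq)
  qed (use assms in simp_all)
  then show ?thesis by (simp add: D_def algebra_simps)
qed

end

section \<open>The expected discrepancy as a functional of the corner areas\<close>

text \<open>Lebesgue measure on the square, seen as a probability measure on the plane: bounded
  measurable functions are then integrable, and Fubini applies to its products.\<close>

definition unit_square_measure :: "(real \<times> real) measure" where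
  "unit_square_measure = uniform_measure lborel unit_square"

lemma fst_snd_borel [measurable]:
  "(fst :: real \<times> real \<Rightarrow> real) \<in> borel_measurable borel"
  "(snd :: real \<times> real \<Rightarrow> real) \<in> borel_measurable borel"
  by (simp_all add: borel_prod[symmetric])

abbreviation "USQ \<equiv> unit_square_measure"

lemma sets_USQ [measurable_cong, simp]: "sets USQ = sets borel"
  and space_USQ [simp]: "space USQ = UNIV"
  by (simp_all add: unit_square_measure_def)

interpretation USQ: prob_space USQ
  unfolding unit_square_measure_def
  by (rule prob_space_uniform_measure) (simp_all add: measure_unit_square)

lemma AE_USQ: "AE z in USQ. z \<in> unit_square"
  unfolding unit_square_measure_def by (rule AE_uniform_measureI) simp_all

lemma set_lebesgue_integral_unit_square:
  assumes "f \<in> borel_measurable borel"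
  shows "(LINT z:unit_square|lborel. f z :: real) = integral\<^sup>L USQ f"
proof -
  have "integral\<^sup>L USQ f = integral\<^sup>L (density lborel (\<lambda>z. ennreal (indicator unit_square z))) f"
    by (simp add: unit_square_measure_def uniform_measure_def measure_unit_square ennreal_indicator divide_ennreal_def)
  also have "\<dots> = (LINT z:unit_square|lborel. f z)"
    using assms unfolding set_lebesgue_integral_def by (subst integral_density) simp_all
  finally show ?thesis by simp
qed

lemma USQ_measure:
  assumes "A \<in> sets borel" "A \<subseteq> unit_square"
  shows "measure USQ A = measure lborel A"
proof -
  have "unit_square \<inter> A = A" using assms by auto
  then show ?thesis
    using assms unfolding unit_square_measure_def
    by (subst measure_uniform_measure) (simp_all add: measure_unit_square)
qed

text \<open>\<open>z\<close> is the upper right corner of a box and \<open>u\<close> a point. Both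
  are arguments because the function is integrated over points for a fixed box and, after Fubini,
  over boxes for a fixed point.\<close>

definition corner_event :: "real \<times> real \<Rightarrow> real \<times> real \<Rightarrow> real" where
  "corner_event z u = (if u \<in> {0..fst z} \<times> {0..snd z} then 1 else 0)"

lemma corner_event_measurable [measurable]:
  "(\<lambda>w. corner_event (fst w) (snd w)) \<in> borel_measurable (borel \<Otimes>\<^sub>M borel)"
  unfolding corner_event_def mem_Times_iff atLeastAtMost_iff by (simp add: borel_prod[symmetric])

text \<open>Here \<open>q\<close> and \<open>r\<close> are the probabilities that the first and the
  second point fall into a box of area \<open>w\<close>. The value is the expected squared deviation
  at that box, since the two hits are independent and an indicator equals its square.\<close>

definition discrepancy_functional :: "real \<Rightarrow> real \<Rightarrow> real \<Rightarrow> real" where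
  "discrepancy_functional p w A =
     (let q = A / p; r = (w - A) / (1 - p) in (q + r + 2 * q * r) / 4 - w * (q + r) + w\<^sup>2)"

lemma integral_uniform_corner_event:
  assumes S: "S \<in> sets borel" "S \<subseteq> unit_square" and pos: "measure lborel S > 0"
  shows "integral\<^sup>L (uniform_measure lborel S) (corner_event z)
    = measure lborel (S \<inter> ({0..fst z} \<times> {0..snd z})) / measure lborel S"
proof -
  let ?Q = "{0..fst z} \<times> {0..snd z}"
  have Q: "?Q \<in> sets borel" by (intro borel_closed closed_Times) simp_all
  have em: "emeasure lborel S \<noteq> 0" "emeasure lborel S \<noteq> \<infinity>"
    using pos by (auto simp: measure_def)
  interpret prob_space "uniform_measure lborel S"
    using em by (rule prob_space_uniform_measure)
  have "corner_event z = indicator ?Q" by (auto simp: corner_event_def indicator_def)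
  then have "integral\<^sup>L (uniform_measure lborel S) (corner_event z)
    = integral\<^sup>L (uniform_measure lborel S) (indicator ?Q)" by simp
  also have "\<dots> = measure (uniform_measure lborel S) ?Q"
    using Q by simp
  also have "\<dots> = measure lborel (S \<inter> ?Q) / measure lborel S"
    using S Q em by (intro measure_uniform_measure) simp_all
  finally show ?thesis .
qed

lemma corner_event_bounds: "0 \<le> corner_event z u" "corner_event z u \<le> 1"
  by (simp_all add: corner_event_def)

lemma corner_event_measurable' [measurable]: "corner_event z \<in> borel_measurable borel"
  "(\<lambda>z. corner_event z u) \<in> borel_measurable borel"
  unfolding corner_event_def mem_Times_iff atLeastAtMost_iff by (simp_all add: borel_prod[symmetric])

definition two_point_deviation :: "(real \<times> real) \<times> (real \<times> real) \<Rightarrow> real \<times> real \<Rightarrow> real" where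
  "two_point_deviation w z =
     ((corner_event z (fst w) + corner_event z (snd w)) / 2 - fst z * snd z)\<^sup>2"

lemma two_point_deviation_measurable [measurable]:
  "(\<lambda>(w, z). two_point_deviation w z) \<in> borel_measurable ((borel \<Otimes>\<^sub>M borel) \<Otimes>\<^sub>M borel)"
  "two_point_deviation w \<in> borel_measurable borel"
  unfolding two_point_deviation_def corner_event_def split_beta mem_Times_iff atLeastAtMost_iff
  by (simp_all add: borel_prod[symmetric])

lemma two_point_deviation_bounded:
  assumes "z \<in> unit_square"
  shows "\<bar>two_point_deviation w z\<bar> \<le> 1"
proof -
  let ?t = "(corner_event z (fst w) + corner_event z (snd w)) / 2 - fst z * snd z"
  have "0 \<le> fst z * snd z" "fst z * snd z \<le> 1"
    using assms by (auto simp: unit_square_def intro: mult_le_one)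
  moreover have "\<bar>(a + b) / 2 - c\<bar> \<le> 1"
    if "0 \<le> a" "a \<le> 1" "0 \<le> b" "b \<le> 1" "0 \<le> c" "c \<le> 1" for a b c :: real
    using that by (simp add: abs_le_iff field_simps)
  ultimately have "\<bar>?t\<bar> \<le> 1" by (simp add: corner_event_bounds)
  then have "?t\<^sup>2 \<le> 1" by (rule abs_le_square_iff[THEN iffD1, of _ 1, simplified])
  then show ?thesis by (simp add: two_point_deviation_def)
qed

text \<open>Coinciding points are no exception: for \<open>u = v\<close> the set has one element,
  and the hit ratio is still the mean of the two indicators.\<close>

lemma sq_L2_discrepancy_two_points:
  "sq_L2_discrepancy {u, v} = integral\<^sup>L USQ (two_point_deviation (u, v))"
proof -
  have "real (card ({u, v} \<inter> ({0..fst z} \<times> {0..snd z}))) / real (card {u, v})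
      = (corner_event z u + corner_event z v) / 2" for z
    by (cases "u = v") (simp_all add: corner_event_def Int_insert_left)
  then have "sq_L2_discrepancy {u, v} = (LINT z:unit_square|lborel. two_point_deviation (u, v) z)"
    unfolding sq_L2_discrepancy_def two_point_deviation_def power2_abs fst_conv snd_conv
    by (simp only:)
  then show ?thesis by (simp add: set_lebesgue_integral_unit_square)
qed

lemma corner_area_eq_expectation:
  assumes "region g \<in> sets borel"
  shows "corner_area g x y = (LINT u|USQ. indicator (region g) u * corner_event (x, y) u)"
proof -
  let ?S = "region g \<inter> ({0..x} \<times> {0..y})"
  have S: "?S \<in> sets borel"
    using assms by (rule sets.Int) (intro borel_closed closed_Times closed_atLeastAtMost)
  have "indicator (region g) u * corner_event (x, y) u = indicator ?S u" for u
    by (simp add: corner_event_def indicator_def)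
  then have "(LINT u|USQ. indicator (region g) u * corner_event (x, y) u) = measure USQ ?S"
    using S by simp
  also have "\<dots> = corner_area g x y"
    using S by (subst USQ_measure) (auto simp: corner_area_def region_def)
  finally show ?thesis by simp
qed

lemma corner_area_measurable [measurable]:
  assumes [measurable]: "region g \<in> sets borel"
  shows "(\<lambda>z. corner_area g (fst z) (snd z)) \<in> borel_measurable borel"
proof -
  have "(\<lambda>z. LINT u|USQ. indicator (region g) u * corner_event z u) \<in> borel_measurable borel"
    by (rule USQ.borel_measurable_lebesgue_integral) measurable
  then show ?thesis by (simp add: corner_area_eq_expectation[OF assms])
qed

text \<open>Fubini moves the expectation inside the integral over box corners; for a fixed box,
  independence reduces it to the two hit probabilities.\<close>

lemma expected_sq_L2_discrepancy_eq:
  assumes S: "region g \<in> sets borel" and p: "measure lborel (region g) = p" "0 < p" "p < 1"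
  shows "expected_sq_L2_discrepancy g
    = (LINT z|USQ. discrepancy_functional p (fst z * snd z) (corner_area g (fst z) (snd z)))"
proof -
  let ?R = "region g" and ?T = "unit_square - region g"
  define M1 where "M1 = uniform_measure lborel ?R"
  define M2 where "M2 = uniform_measure lborel ?T"
  have sub: "?R \<subseteq> unit_square" "?T \<subseteq> unit_square" by (auto simp: region_def)
  have T: "?T \<in> sets borel" using S by simp
  have T': "measure lborel ?T = 1 - p"
    using S sub by (subst measure_Diff) (simp_all add: measure_unit_square p)
  have [measurable_cong, simp]: "sets M1 = sets borel" "sets M2 = sets borel"
    by (simp_all add: M1_def M2_def)
  interpret M1: prob_space M1
    using p unfolding M1_def by (intro prob_space_uniform_measure) (auto simp: measure_def)
  interpret M2: prob_space M2
    using p T' unfolding M2_def by (intro prob_space_uniform_measure) (auto simp: measure_def)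
  interpret M12: pair_prob_space M1 M2 ..
  interpret M: pair_prob_space "M1 \<Otimes>\<^sub>M M2" USQ ..
  have meas: "(\<lambda>(w, z). two_point_deviation w z) \<in> borel_measurable ((M1 \<Otimes>\<^sub>M M2) \<Otimes>\<^sub>M USQ)"
    using two_point_deviation_measurable(1)
    by (subst measurable_cong_sets[OF sets_pair_measure_cong refl]) (auto cong: sets_pair_measure_cong)
  have bounded: "AE x in (M1 \<Otimes>\<^sub>M M2) \<Otimes>\<^sub>M USQ. norm (case x of (w, z) \<Rightarrow> two_point_deviation w z) \<le> 1"
  proof (rule M.AE_pair_measure)
    show "AE w in M1 \<Otimes>\<^sub>M M2. AE z in USQ. norm (case (w, z) of (w, z) \<Rightarrow> two_point_deviation w z) \<le> 1"
    proof (rule AE_I2)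
      fix w
      show "AE z in USQ. norm (case (w, z) of (w, z) \<Rightarrow> two_point_deviation w z) \<le> 1"
        using AE_USQ by eventually_elim (use two_point_deviation_bounded in simp)
    qed
  qed (use meas in measurable)
  have "expected_sq_L2_discrepancy g = (LINT w|(M1 \<Otimes>\<^sub>M M2). LINT z|USQ. two_point_deviation w z)"
    by (simp add: expected_sq_L2_discrepancy_def M1_def M2_def sq_L2_discrepancy_two_points)
  also have "\<dots> = (LINT z|USQ. LINT w|(M1 \<Otimes>\<^sub>M M2). two_point_deviation w z)"
    by (intro M.Fubini_integral[symmetric] M.integrable_const_bound[OF bounded] meas)
  also have "\<dots> = (LINT z|USQ. discrepancy_functional p (fst z * snd z) (corner_area g (fst z) (snd z)))"
  proof (rule integral_cong_AE)
    show "AE z in USQ. (LINT w|(M1 \<Otimes>\<^sub>M M2). two_point_deviation w z)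
       = discrepancy_functional p (fst z * snd z) (corner_area g (fst z) (snd z))"
      using AE_USQ
    proof eventually_elim
      case (elim z)
      let ?Q = "{0..fst z} \<times> {0..snd z}" and ?w = "fst z * snd z"
      define q where "q = corner_area g (fst z) (snd z) / p"
      define r where "r = (?w - corner_area g (fst z) (snd z)) / (1 - p)"
      have Q: "?Q \<in> sets borel" "?Q \<subseteq> unit_square"
        using elim by (auto simp: unit_square_def intro!: borel_closed closed_Times)
      have q: "integral\<^sup>L M1 (corner_event z) = q"
        unfolding M1_def q_def corner_area_def
        using integral_uniform_corner_event[OF S sub(1)] p by simp
      have "emeasure (lborel \<Otimes>\<^sub>M lborel) ?Q = ennreal ?w"
        using elim by (subst lborel.emeasure_pair_measure_Times) (auto simp: unit_square_def ennreal_mult)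
      then have mQ: "measure lborel ?Q = ?w" "emeasure lborel ?Q \<noteq> \<infinity>"
        using elim unfolding lborel_prod by (auto simp: unit_square_def measure_def)
      have TQ: "?T \<inter> ?Q = ?Q - ?R \<inter> ?Q" using Q by auto
      have RQ: "?R \<inter> ?Q \<in> sets borel" using S Q(1) by (rule sets.Int)
      have "measure lborel (?T \<inter> ?Q) = ?w - corner_area g (fst z) (snd z)"
        unfolding TQ using Q(1) RQ mQ by (subst measure_Diff) (simp_all add: corner_area_def)
      then have r: "integral\<^sup>L M2 (corner_event z) = r"
        unfolding M2_def r_def
        using integral_uniform_corner_event[OF T sub(2)] p T' by simp
      have ce: "\<bar>corner_event z u\<bar> \<le> 1" for u by (simp add: corner_event_def)
      have int: "integrable M1 (corner_event z)" "integrable M2 (corner_event z)"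
        by (intro M1.integrable_const_bound[where B=1] M2.integrable_const_bound[where B=1]; simp add: ce)+
      \<comment> \<open>As indicators are idempotent, the square is affine in
        \<open>corner_event z v\<close>; the inner integral then involves only \<open>r\<close>, and
        the outer one only \<open>q\<close>.\<close>
      have dev: "two_point_deviation (u, v) z
        = corner_event z u / 4 - ?w * corner_event z u + ?w\<^sup>2
          + (1 / 4 + corner_event z u / 2 - ?w) * corner_event z v" for u v
        by (simp add: two_point_deviation_def corner_event_def power2_eq_square field_simps)
      have int': "integrable (M1 \<Otimes>\<^sub>M M2) (\<lambda>w. two_point_deviation w z)"
        using two_point_deviation_bounded[OF elim]
        by (intro M12.integrable_const_bound[where B=1]) (auto simp: two_point_deviation_def)
      have "(LINT w|(M1 \<Otimes>\<^sub>M M2). two_point_deviation w z)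
          = (LINT u|M1. LINT v|M2. two_point_deviation (u, v) z)"
        by (rule M12.integral_fst'[OF int', symmetric])
      also have "\<dots> = (LINT u|M1. r / 4 - ?w * r + ?w\<^sup>2 + (1 / 4 + r / 2 - ?w) * corner_event z u)"
        using int by (simp add: dev r M2.prob_space algebra_simps)
      also have "\<dots> = r / 4 - ?w * r + ?w\<^sup>2 + (1 / 4 + r / 2 - ?w) * q"
        using int by (simp add: q M1.prob_space)
      also have "\<dots> = discrepancy_functional p ?w (corner_area g (fst z) (snd z))"
        unfolding discrepancy_functional_def Let_def q_def[symmetric] r_def[symmetric]
        by (simp add: algebra_simps)
      finally show ?case .
    qed
    show "(\<lambda>z. LINT w|(M1 \<Otimes>\<^sub>M M2). two_point_deviation w z) \<in> borel_measurable USQ"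
      using meas by (intro M12.borel_measurable_lebesgue_integral) (simp add: measurable_pair_swap_iff[of _ USQ] split_beta)
    show "(\<lambda>z. discrepancy_functional p (fst z * snd z) (corner_area g (fst z) (snd z))) \<in> borel_measurable USQ"
      using S unfolding discrepancy_functional_def Let_def by measurable
  qed
  finally show ?thesis .
qed

section \<open>Linearisation of the expected discrepancy\<close>

text \<open>The derivative of \<open>p * (1 - p) * discrepancy_functional p w A\<close> with respect
  to \<open>A\<close>, taken at the corner area of \<open>g\<close>.\<close>

definition variation_density :: "real \<Rightarrow> (real \<Rightarrow> real) \<Rightarrow> real \<times> real \<Rightarrow> real" where
  "variation_density p g z =
     (1 - 2 * p) / 4 + (2 * p - 1 / 2) * (fst z * snd z) - corner_area g (fst z) (snd z)"

definition variation_kernel :: "real \<Rightarrow> (real \<Rightarrow> real) \<Rightarrow> real \<Rightarrow> real \<Rightarrow> real" where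
  "variation_kernel p g = corner_integral (variation_density p g)"

lemma discrepancy_functional_expand:
  assumes "0 < p" "p < 1"
  shows "p * (1 - p) * discrepancy_functional p w A =
    (1 - 2 * p) / 4 * A + p / 4 * w + (2 * p - 1 / 2) * (w * A) - p\<^sup>2 * (w * w) - 1 / 2 * (A * A)"
proof -
  have "p \<noteq> 0" "1 - p \<noteq> 0" using assms by simp_all
  then show ?thesis
    unfolding discrepancy_functional_def Let_def
    by (simp add: divide_simps) (simp add: algebra_simps power2_eq_square)
qed

context
  fixes p :: real and g h :: "real \<Rightarrow> real"
  assumes p: "0 < p" "p < 1"
    and g: "region g \<in> sets borel" "measure lborel (region g) = p"
    and h: "region h \<in> sets borel" "measure lborel (region h) = p"
begin

lemma functional_integrable:
  assumes f: "region f \<in> sets borel"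
  shows "integrable USQ (\<lambda>z. p * (1 - p) * discrepancy_functional p (fst z * snd z) (corner_area f (fst z) (snd z)))"
proof -
  let ?w = "\<lambda>z::real \<times> real. fst z * snd z" and ?A = "\<lambda>z. corner_area f (fst z) (snd z)"
  note [measurable] = f
  have w: "AE z in USQ. \<bar>?w z\<bar> \<le> 1"
    using AE_USQ by eventually_elim (auto simp: unit_square_def abs_mult intro!: mult_le_one)
  have A: "AE z in USQ. \<bar>?A z\<bar> \<le> 1"
    using corner_area_bounds[OF f] by simp
  have prod: "integrable USQ (\<lambda>z. u z * v z)"
    if [measurable]: "u \<in> borel_measurable borel" "v \<in> borel_measurable borel"
      and b: "AE z in USQ. \<bar>u z\<bar> \<le> 1" "AE z in USQ. \<bar>v z\<bar> \<le> 1" for u v :: "real \<times> real \<Rightarrow> real"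
  proof (rule USQ.integrable_const_bound[where B=1])
    show "AE z in USQ. norm (u z * v z) \<le> 1"
      using b by eventually_elim (simp add: abs_mult mult_le_one)
  qed measurable
  have "integrable USQ ?w" "integrable USQ ?A"
    using w A by (auto intro!: USQ.integrable_const_bound[where B=1])
  moreover have "integrable USQ (\<lambda>z. ?w z * ?A z)" "integrable USQ (\<lambda>z. ?w z * ?w z)"
    "integrable USQ (\<lambda>z. ?A z * ?A z)"
    by (intro prod w A; simp)+
  ultimately show ?thesis
    unfolding discrepancy_functional_expand[OF p]
    by (intro Bochner_Integration.integrable_add Bochner_Integration.integrable_diff integrable_mult_right)
qed

lemma variation_density_measurable [measurable]: "variation_density p g \<in> borel_measurable borel"
  using g(1) unfolding variation_density_def by measurable

text \<open>The three summands are at most 1/4, 3/2 and 1 in absolute value.\<close>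

lemma variation_density_bounded:
  assumes "z \<in> unit_square"
  shows "\<bar>variation_density p g z\<bar> \<le> 3"
proof -
  have "0 \<le> fst z * snd z" "fst z * snd z \<le> 1"
    using assms by (auto simp: unit_square_def intro: mult_le_one)
  moreover have "\<bar>2 * p - 1 / 2\<bar> \<le> 3 / 2" using p by arith
  ultimately have "\<bar>2 * p - 1 / 2\<bar> * \<bar>fst z * snd z\<bar> \<le> 3 / 2 * 1"
    by (intro mult_mono) simp_all
  then have "\<bar>(2 * p - 1 / 2) * (fst z * snd z)\<bar> \<le> 3 / 2" by (simp only: abs_mult)
  moreover have "\<bar>(1 - 2 * p) / 4\<bar> \<le> 1 / 4" using p by auto
  moreover note corner_area_bounds[OF g(1), of "fst z" "snd z"]
  ultimately show ?thesis unfolding variation_density_def by arith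
qed

text \<open>For a quadratic polynomial the expansion at \<open>g\<close> is exact: the integrands
  differ by the linear term minus half the squared change of the corner area, and this square is
  dropped.\<close>

lemma expected_variation_le:
  "p * (1 - p) * (expected_sq_L2_discrepancy h - expected_sq_L2_discrepancy g)
    \<le> (LINT z|USQ. variation_density p g z
          * (corner_area h (fst z) (snd z) - corner_area g (fst z) (snd z)))"
proof -
  let ?\<phi> = "\<lambda>f z. p * (1 - p) * discrepancy_functional p (fst z * snd z) (corner_area f (fst z) (snd z))"
  let ?\<delta> = "\<lambda>z. corner_area h (fst z) (snd z) - corner_area g (fst z) (snd z)"
  have "p * (1 - p) * (expected_sq_L2_discrepancy h - expected_sq_L2_discrepancy g)
    = integral\<^sup>L USQ (?\<phi> h) - integral\<^sup>L USQ (?\<phi> g)"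
    using expected_sq_L2_discrepancy_eq[OF g p] expected_sq_L2_discrepancy_eq[OF h p]
    by (simp add: right_diff_distrib)
  also have "\<dots> = (LINT z|USQ. ?\<phi> h z - ?\<phi> g z)"
    by (intro Bochner_Integration.integral_diff[symmetric] functional_integrable g h)
  also have "\<dots> \<le> (LINT z|USQ. variation_density p g z * ?\<delta> z)"
  proof (rule integral_mono_AE)
    show "integrable USQ (\<lambda>z. ?\<phi> h z - ?\<phi> g z)"
      by (intro Bochner_Integration.integrable_diff functional_integrable g h)
    show "integrable USQ (\<lambda>z. variation_density p g z * ?\<delta> z)"
    proof (rule USQ.integrable_const_bound[where B=3])
      show "AE z in USQ. norm (variation_density p g z * ?\<delta> z) \<le> 3"
        using AE_USQ
      proof eventually_elim
        case (elim z)
        have "\<bar>?\<delta> z\<bar> \<le> 1"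
          using corner_area_bounds[OF g(1), of "fst z" "snd z"] corner_area_bounds[OF h(1), of "fst z" "snd z"]
          by arith
        then have "\<bar>variation_density p g z\<bar> * \<bar>?\<delta> z\<bar> \<le> 3 * 1"
          using variation_density_bounded[OF elim] by (intro mult_mono) simp_all
        then show ?case by (simp add: abs_mult)
      qed
    qed (use corner_area_measurable[OF g(1)] corner_area_measurable[OF h(1)] in simp)
    have "?\<phi> h z - ?\<phi> g z = variation_density p g z * ?\<delta> z - (?\<delta> z)\<^sup>2 / 2" for z
      unfolding discrepancy_functional_expand[OF p] variation_density_def
      by (simp add: field_simps power2_eq_square)
    then show "AE z in USQ. ?\<phi> h z - ?\<phi> g z \<le> variation_density p g z * ?\<delta> z" by simp
  qed
  finally show ?thesis .
qed

text \<open>The box with corner \<open>z\<close> contains \<open>u\<close> exactly when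
  \<open>z\<close> lies to the upper right of \<open>u\<close>, which explains the integration range
  of the kernel.\<close>

lemma variation_kernel_eq_expectation:
  assumes cont: "continuous_on unit_square (variation_density p g)" and u: "u \<in> unit_square"
  shows "(LINT z|USQ. corner_event z u * variation_density p g z) = variation_kernel p g (fst u) (snd u)"
proof -
  have "(LINT z|USQ. corner_event z u * variation_density p g z)
     = (LINT z:unit_square|lborel. corner_event z u * variation_density p g z)"
    by (rule set_lebesgue_integral_unit_square[symmetric]) simp
  also have "\<dots> = (LINT z:{fst u..1} \<times> {snd u..1}|lborel. variation_density p g z)"
    unfolding set_lebesgue_integral_def
    by (intro Bochner_Integration.integral_cong refl)
      (use u in \<open>auto simp: corner_event_def indicator_def unit_square_def mem_Times_iff\<close>)
  also have "\<dots> = variation_kernel p g (fst u) (snd u)"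
    using u by (auto simp: variation_kernel_def unit_square_def corner_integral_eq_lebesgue[OF cont])
  finally show ?thesis .
qed

text \<open>A point gained or lost by the region counts in the corner area of every box containing
  it; Fubini collects these contributions point by point.\<close>

lemma variation_kernel_integral:
  assumes cont: "continuous_on unit_square (variation_density p g)"
  shows "(LINT z|USQ. variation_density p g z
          * (corner_area h (fst z) (snd z) - corner_area g (fst z) (snd z)))
    = (LINT u|USQ. (indicator (region h) u - indicator (region g) u) * variation_kernel p g (fst u) (snd u))"
proof -
  note [measurable] = g(1) h(1)
  interpret P: pair_prob_space USQ USQ ..
  let ?i = "\<lambda>u. indicator (region h) u - indicator (region g) u :: real"
  let ?F = "\<lambda>z u. variation_density p g z * (?i u * corner_event z u)"
  have F [measurable]: "(\<lambda>(z, u). ?F z u) \<in> borel_measurable (USQ \<Otimes>\<^sub>M USQ)"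
    by measurable
  have ce: "\<bar>?i u * corner_event z u\<bar> \<le> 1" for z u
    by (simp add: corner_event_def indicator_def)
  have "AE x in USQ \<Otimes>\<^sub>M USQ. norm (case x of (z, u) \<Rightarrow> ?F z u) \<le> 3"
  proof (rule P.AE_pair_measure)
    show "AE z in USQ. AE u in USQ. norm (case (z, u) of (z, u) \<Rightarrow> ?F z u) \<le> 3"
      using AE_USQ
    proof eventually_elim
      case (elim z)
      have "\<bar>variation_density p g z\<bar> * \<bar>?i u * corner_event z u\<bar> \<le> 3 * 1" for u
        using variation_density_bounded[OF elim] ce by (intro mult_mono) simp_all
      then show ?case by (simp add: abs_mult)
    qed
  qed measurable
  then have int: "integrable (USQ \<Otimes>\<^sub>M USQ) (\<lambda>(z, u). ?F z u)"
    by (intro P.integrable_const_bound F)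
  have diff: "corner_area h (fst z) (snd z) - corner_area g (fst z) (snd z)
      = (LINT u|USQ. ?i u * corner_event z u)" for z
  proof -
    have "integrable USQ (\<lambda>u. indicator (region f) u * corner_event z u)"
      if [measurable]: "region f \<in> sets borel" for f
    proof (rule USQ.integrable_const_bound[where B=1])
      show "AE u in USQ. norm (indicator (region f) u * corner_event z u) \<le> 1"
        by (simp add: corner_event_def indicator_def)
    qed measurable
    then show ?thesis
      by (simp add: corner_area_eq_expectation g h left_diff_distrib Bochner_Integration.integral_diff)
  qed
  have "(LINT z|USQ. variation_density p g z
          * (corner_area h (fst z) (snd z) - corner_area g (fst z) (snd z)))
      = (LINT z|USQ. LINT u|USQ. ?F z u)"
    by (simp add: diff)
  also have "\<dots> = (LINT u|USQ. LINT z|USQ. ?F z u)"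
    by (rule P.Fubini_integral[symmetric, OF int])
  also have "\<dots> = (LINT u|USQ. ?i u * (LINT z|USQ. corner_event z u * variation_density p g z))"
    by (simp add: mult.assoc mult.left_commute mult.commute flip: integral_mult_right_zero)
  also have "\<dots> = (LINT u|USQ. ?i u * variation_kernel p g (fst u) (snd u))"
  proof (rule Bochner_Integration.integral_cong)
    fix u
    show "?i u * (LINT z|USQ. corner_event z u * variation_density p g z)
        = ?i u * variation_kernel p g (fst u) (snd u)"
      using variation_kernel_eq_expectation[OF cont, of u]
      by (cases "u \<in> unit_square") (simp_all add: region_def)
  qed simp
  finally show ?thesis .
qed

end

section \<open>Symmetric curves from their upper halves\<close>

text \<open>The graph of \<open>f\<close> over \<open>{0..c}\<close> continued by its mirror image;
  when \<open>f c = c\<close>, the two pieces meet on the diagonal.\<close>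

definition symmetric_completion :: "(real \<Rightarrow> real) \<Rightarrow> real \<Rightarrow> real \<Rightarrow> real \<Rightarrow> real" where
  "symmetric_completion f c a x =
     (if x \<le> c then f x else if x \<le> a then inv_into {0..c} f x else 0)"

locale upper_half =
  fixes f :: "real \<Rightarrow> real" and c a :: real
  assumes c: "0 < c" "c < a" and a: "a \<le> 1"
    and f_0: "f 0 = a" and f_c: "f c = c"
    and cont: "continuous_on {0..c} f"
    and strict: "\<And>x y. 0 \<le> x \<Longrightarrow> x < y \<Longrightarrow> y \<le> c \<Longrightarrow> f y < f x"
begin

abbreviation "h \<equiv> symmetric_completion f c a"

lemma f_inj: "inj_on f {0..c}"
  using strict by (intro linorder_inj_onI) force+

lemma f_image: "f ` {0..c} = {c..a}"
proof
  show "f ` {0..c} \<subseteq> {c..a}"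
  proof
    fix y assume "y \<in> f ` {0..c}"
    then obtain x where x: "0 \<le> x" "x \<le> c" "y = f x" by auto
    then have "f c \<le> f x" "f x \<le> f 0"
      using strict[of x c] strict[of 0 x] by (cases "x = c", simp_all) (cases "x = 0", simp_all)
    then show "y \<in> {c..a}" using x f_0 f_c by simp
  qed
  show "{c..a} \<subseteq> f ` {0..c}"
  proof
    fix y assume "y \<in> {c..a}"
    then have "\<exists>x. 0 \<le> x \<and> x \<le> c \<and> f x = y"
      using IVT2'[of f c y 0] c f_0 f_c cont by simp
    then show "y \<in> f ` {0..c}" by force
  qed
qed

lemma f_mem: "x \<in> {0..c} \<Longrightarrow> f x \<in> {c..a}"
  using f_image by (metis imageI)

lemma inv_f: "x \<in> {0..c} \<Longrightarrow> inv_into {0..c} f (f x) = x"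
  by (rule inv_into_f_f[OF f_inj])

lemma f_inv: "y \<in> {c..a} \<Longrightarrow> f (inv_into {0..c} f y) = y"
  using f_image f_inv_into_f[of y f "{0..c}"] by simp

lemma inv_mem: "y \<in> {c..a} \<Longrightarrow> inv_into {0..c} f y \<in> {0..c}"
  using f_image inv_into_into[of y f "{0..c}"] by simp

lemma h_lower: "x \<in> {0..c} \<Longrightarrow> h x = f x"
  by (simp add: symmetric_completion_def)

lemma h_upper:
  assumes "x \<in> {c..a}"
  shows "h x = inv_into {0..c} f x"
proof (cases "x = c")
  case True
  then show ?thesis using inv_f[of c] f_c c by (simp add: symmetric_completion_def)
next
  case False
  then show ?thesis using assms by (simp add: symmetric_completion_def)
qed

lemma h_beyond: "a < x \<Longrightarrow> h x = 0"
  using c by (simp add: symmetric_completion_def)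

lemma h_involution:
  assumes "x \<in> {0..a}"
  shows "h x \<in> {0..a} \<and> h (h x) = x"
proof (cases "x \<le> c")
  case True
  then have x: "x \<in> {0..c}" using assms by simp
  then show ?thesis using f_mem[OF x] inv_f[OF x] c by (simp add: h_lower h_upper)
next
  case False
  then have x: "x \<in> {c..a}" using assms by simp
  then show ?thesis using inv_mem[OF x] f_inv[OF x] c by (simp add: h_lower h_upper)
qed

lemma h_a: "h a = 0"
  using inv_f[of 0] f_0 c by (simp add: h_upper)

lemma h_nonneg: "0 \<le> x \<Longrightarrow> 0 \<le> h x"
  using h_involution[of x] h_beyond[of x] by (cases "x \<le> a") simp_all

lemma symmetric_graph_h: "symmetric_graph h a"
  unfolding symmetric_graph_def
proof (intro conjI ballI)
  show "bij_betw h {0..a} {0..a}"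
    by (rule bij_betw_byWitness[where f'=h]) (use h_involution in blast)+
  show "h 0 = a" using c f_0 by (simp add: h_lower)
  fix x assume "x \<in> {a..1}"
  then show "h x = 0" using h_a h_beyond[of x] by (cases "x = a") simp_all
qed (use h_a c a h_involution in simp_all)

lemma h_antimono: "antimono_on {0..1} h"
proof (rule monotone_onI)
  fix x y :: real assume xy: "x \<in> {0..1}" "y \<in> {0..1}" "x \<le> y"
  consider "y \<le> c" | "x \<le> c" "c < y" "y \<le> a" | "c < x" "y \<le> a" | "a < y" by linarith
  then show "h y \<le> h x"
  proof cases
    case 1
    then show ?thesis using xy strict[of x y] by (cases "x = y") (simp_all add: h_lower)
  next
    case 2
    then show ?thesis using xy f_mem[of x] inv_mem[of y] by (simp add: h_lower h_upper)
  next
    case 3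
    then have m: "x \<in> {c..a}" "y \<in> {c..a}" using xy by simp_all
    show ?thesis
    proof (rule ccontr)
      assume "\<not> h y \<le> h x"
      then have "inv_into {0..c} f x < inv_into {0..c} f y" using m by (simp add: h_upper)
      then have "f (inv_into {0..c} f y) < f (inv_into {0..c} f x)"
        using inv_mem[OF m(1)] inv_mem[OF m(2)] by (intro strict) simp_all
      then show False using f_inv[OF m(1)] f_inv[OF m(2)] xy by simp
    qed
  next
    case 4
    then show ?thesis using h_beyond h_nonneg xy by simp
  qed
qed

lemma symmetric_curve_h: "symmetric_curve h a"
  using symmetric_graph_h h_antimono by unfold_locales

end

section \<open>Bumps\<close>

definition clamp_to :: "real \<Rightarrow> real \<Rightarrow> real \<Rightarrow> real" where
  "clamp_to l r x = max l (min r x)"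

text \<open>The parabola \<open>(x - l) * (r - x)\<close> on \<open>{l..r}\<close>, continued by
  zero; clamping the argument gives continuity without a case distinction.\<close>

definition bump :: "real \<Rightarrow> real \<Rightarrow> real \<Rightarrow> real" where
  "bump l r x = (clamp_to l r x - l) * (r - clamp_to l r x)"

lemma bump_continuous: "continuous_on S (bump l r)"
  unfolding bump_def clamp_to_def by (intro continuous_intros)

lemma bump_nonneg: "l \<le> r \<Longrightarrow> 0 \<le> bump l r x"
  unfolding bump_def clamp_to_def by (intro mult_nonneg_nonneg) auto

lemma bump_pos: "l < x \<Longrightarrow> x < r \<Longrightarrow> 0 < bump l r x"
  unfolding bump_def clamp_to_def by (intro mult_pos_pos) auto

lemma bump_zero: "l \<le> r \<Longrightarrow> x \<notin> {l<..<r} \<Longrightarrow> bump l r x = 0"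
  unfolding bump_def clamp_to_def by auto

text \<open>On an interval of length at most 1 the parabola has slope at most 1 in absolute value;
  its difference quotient is \<open>l + r - s - t\<close>.\<close>

lemma bump_lipschitz:
  assumes "l \<le> r" "r - l \<le> 1" "x \<le> y"
  shows "\<bar>bump l r y - bump l r x\<bar> \<le> y - x"
proof -
  define s t where "s = clamp_to l r x" and "t = clamp_to l r y"
  have st: "l \<le> s" "s \<le> t" "t \<le> r" "t - s \<le> y - x"
    using assms unfolding s_def t_def clamp_to_def by (auto simp: min_def max_def)
  have "bump l r y - bump l r x = (t - s) * (l + r - s - t)"
    unfolding bump_def s_def[symmetric] t_def[symmetric] by (simp add: algebra_simps)
  also have "\<bar>\<dots>\<bar> \<le> (t - s) * 1"
    unfolding abs_mult using st assms by (intro mult_mono) auto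
  finally show ?thesis using st by simp
qed

text \<open>The bump has Lipschitz constant 1, so a multiple by at most 1/2 leaves the identity at
  least half of its slope.\<close>

lemma bump_shift_strict_mono:
  assumes "l \<le> r" "r - l \<le> 1" "x < y" "\<bar>s\<bar> \<le> 1 / 2"
  shows "x + s * bump l r x < y + s * bump l r y"
proof -
  have "\<bar>s * (bump l r y - bump l r x)\<bar> \<le> 1 / 2 * (y - x)"
    unfolding abs_mult using assms bump_lipschitz[of l r x y] by (intro mult_mono) auto
  then have "s * bump l r x - s * bump l r y \<le> 1 / 2 * (y - x)" by (auto simp: right_diff_distrib)
  then show ?thesis using assms(3) by (simp add: field_simps)
qed

section \<open>The kernel is constant along an optimal curve\<close>

text \<open>To be applied to the kernel at \<open>(x, g y)\<close> and to its negative. A point over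
  \<open>x\<close> between the old and the perturbed curve has the form \<open>(x, g y)\<close> with
  \<open>y\<close> close to \<open>x\<close> but in general different from it, so a bound along the
  curve alone would not do.\<close>

lemma less_on_box:
  fixes F :: "real \<times> real \<Rightarrow> real"
  assumes F: "continuous_on ({0..1} \<times> {0..1}) F" and t: "0 < t" "t < c" "c \<le> 1" and less: "F (t, t) < \<kappa>"
  obtains l r where "0 < l" "l < t" "t < r" "r < c"
    "\<And>x y. x \<in> {l..r} \<Longrightarrow> y \<in> {l..r} \<Longrightarrow> F (x, y) < \<kappa>"
proof -
  have "(t, t) \<in> {0..1} \<times> {0..1}" using t by simp
  then obtain d where d: "0 < d"
    and D: "\<And>z. z \<in> {0..1} \<times> {0..1} \<Longrightarrow> dist z (t, t) < d \<Longrightarrow> dist (F z) (F (t, t)) < \<kappa> - F (t, t)"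
    using F less unfolding continuous_on_iff by (metis diff_gt_0_iff_gt)
  \<comment> \<open>A third of \<open>d\<close> in each coordinate keeps the distance from
    \<open>(t, t)\<close> at most \<open>2 * d / 3\<close>; the midpoints \<open>t / 2\<close> and
    \<open>(t + c) / 2\<close> keep the interval strictly between \<open>0\<close> and
    \<open>c\<close>.\<close>
  define l r where "l = max (t / 2) (t - d / 3)" and "r = min ((t + c) / 2) (t + d / 3)"
  show thesis
  proof (rule that[of l r])
    show lr: "0 < l" "l < t" "t < r" "r < c"
      using t d by (auto simp: l_def r_def min_def max_def field_simps)
    fix x y assume xy: "x \<in> {l..r}" "y \<in> {l..r}"
    then have "t - d / 3 \<le> x" "x \<le> t + d / 3" "t - d / 3 \<le> y" "y \<le> t + d / 3"
      by (simp_all add: l_def r_def)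
    then have "\<bar>x - t\<bar> \<le> d / 3" "\<bar>y - t\<bar> \<le> d / 3" by linarith+
    moreover have "dist (x, y) (t, t) \<le> \<bar>x - t\<bar> + \<bar>y - t\<bar>"
      unfolding dist_Pair_Pair dist_real_def by (rule sqrt_sum_squares_le_sum_abs[THEN order_trans]) simp
    ultimately have "dist (x, y) (t, t) < d" using d by linarith
    moreover have "(x, y) \<in> {0..1} \<times> {0..1}" using xy lr t by auto
    ultimately have "dist (F (x, y)) (F (t, t)) < \<kappa> - F (t, t)" by (intro D)
    then show "F (x, y) < \<kappa>" by (simp add: dist_real_def)
  qed
qed

lemma integral_pos_of_pos_at:
  fixes f :: "real \<Rightarrow> real"
  assumes "continuous_on {a..b} f" "\<And>x. x \<in> {a..b} \<Longrightarrow> 0 \<le> f x" "x \<in> {a..b}" "0 < f x" "a < b"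
  shows "0 < integral {a..b} f"
proof -
  have "f integrable_on {a..b}" using assms by (intro integrable_continuous_real)
  then have "0 \<le> integral {a..b} f" using assms by (intro integral_nonneg)
  moreover have "integral {a..b} f \<noteq> 0"
  proof
    assume "integral {a..b} f = 0"
    then have "(f has_integral 0) (cbox a b)"
      using integrable_integral[OF \<open>f integrable_on {a..b}\<close>] by simp
    then have "f x = 0"
      using assms by (intro has_integral_0_cbox_imp_0[of a b f x]) auto
    then show False using assms by simp
  qed
  ultimately show ?thesis by simp
qed

context symmetric_curve
begin

lemma variation_density_continuous: "continuous_on unit_square (variation_density p g)"
  unfolding variation_density_def by (intro continuous_intros corner_area_continuous)

text \<open>Inherited from the symmetry of the corner areas after exchanging the order of
  integration.\<close>

lemma variation_kernel_commute:
  assumes "u \<in> {0..1}" "v \<in> {0..1}"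
  shows "variation_kernel p g u v = variation_kernel p g v u"
proof -
  have "variation_kernel p g u v
      = integral {v..1} (\<lambda>y. integral {u..1} (\<lambda>x. variation_density p g (x, y)))"
    using assms unfolding variation_kernel_def
    by (intro corner_integral_swap[OF variation_density_continuous]) simp_all
  also have "\<dots> = integral {v..1} (\<lambda>y. integral {u..1} (\<lambda>x. variation_density p g (y, x)))"
  proof (intro integral_cong)
    fix y x assume "y \<in> {v..1}" "x \<in> {u..1}"
    then show "variation_density p g (x, y) = variation_density p g (y, x)"
      using assms corner_area_commute[of x y] by (simp add: variation_density_def mult.commute)
  qed
  also have "\<dots> = variation_kernel p g v u"
    by (simp only: variation_kernel_def corner_integral_def)
  finally show ?thesis .
qed

lemma variation_kernel_has_derivative:
  assumes "u \<in> {0..1}" "v \<in> {0..1}"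
  shows "((\<lambda>(u, v). variation_kernel p g u v) has_derivative
     (\<lambda>(s, t). - integral {v..1} (\<lambda>y. variation_density p g (u, y)) * s
        - integral {u..1} (\<lambda>x. variation_density p g (x, v)) * t))
     (at (u, v) within {0..1} \<times> {0..1})"
  unfolding variation_kernel_def
  by (rule corner_integral_has_derivative[OF variation_density_continuous assms])

lemma variation_kernel_continuous:
  "continuous_on ({0..1} \<times> {0..1}) (\<lambda>(u, v). variation_kernel p g u v)"
  unfolding continuous_on_eq_continuous_within
  using has_derivative_continuous[OF variation_kernel_has_derivative] by auto

lemma variation_kernel_continuous':
  "continuous_on ({0..1} \<times> {0..1}) (\<lambda>(x, y). variation_kernel p g x (g y))"
proof -
  have "continuous_on ({0..1} \<times> {0..1}) (\<lambda>z. (fst z, g (snd z)))"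
    by (intro continuous_intros continuous_on_compose2[OF g_continuous]) auto
  then have "continuous_on ({0..1} \<times> {0..1}) (\<lambda>z. (\<lambda>(u, v). variation_kernel p g u v) (fst z, g (snd z)))"
    by (rule continuous_on_compose2[OF variation_kernel_continuous])
      (use g_range(1) g_le_1 in auto)
  then show ?thesis by (simp add: split_beta)
qed

lemma variation_kernel_integrable:
  assumes [measurable]: "A \<in> sets borel" and A: "A \<subseteq> unit_square"
  shows "integrable USQ (\<lambda>u. indicator A u * variation_kernel p g (fst u) (snd u))"
proof -
  let ?k = "\<lambda>u. variation_kernel p g (fst u) (snd u)"
  have cont: "continuous_on unit_square ?k"
    using variation_kernel_continuous by (simp add: unit_square_def split_beta)
  have "compact unit_square" by (auto simp: unit_square_def intro: compact_Times)
  then obtain M where M: "\<And>u. u \<in> unit_square \<Longrightarrow> norm (?k u) \<le> M"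
    using compact_imp_bounded[OF compact_continuous_image[OF cont]] by (auto simp: bounded_iff)
  \<comment> \<open>Continuity of the kernel is known on the square only; measurability is obtained
    for its extension by zero.\<close>
  have eq: "indicator A u * ?k u = indicator A u * (indicator unit_square u *\<^sub>R ?k u)" for u
    using A by (auto simp: indicator_def)
  have [measurable]: "(\<lambda>u. indicator unit_square u *\<^sub>R ?k u) \<in> borel_measurable borel"
    by (rule borel_measurable_continuous_on_indicator[OF unit_square_borel cont])
  show ?thesis
  proof (rule USQ.integrable_const_bound[where B=M])
    show "AE u in USQ. norm (indicator A u * ?k u) \<le> M"
      using AE_USQ by eventually_elim (use M in \<open>fastforce simp: indicator_def\<close>)
    show "(\<lambda>u. indicator A u * ?k u) \<in> borel_measurable USQ"
      unfolding eq by measurable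
  qed
qed

lemma admissible_iff: "g \<in> admissible p \<longleftrightarrow> measure lborel (region g) = p"
proof -
  have "g ` {0..1} \<subseteq> {0..1}" using g_range(1) g_le_1 by auto
  then show ?thesis using sym anti by (auto simp: admissible_def)
qed

end

lemma optimal_first_variation:
  assumes p: "0 < p" "p < 1" and opt: "optimal p g"
    and g: "symmetric_curve g a" and h: "symmetric_curve h b"
    and area: "measure lborel (region h) = p"
  shows "0 \<le> (LINT u|USQ. (indicator (region h) u - indicator (region g) u) * variation_kernel p g (fst u) (snd u))"
proof -
  interpret G: symmetric_curve g a by (rule g)
  interpret H: symmetric_curve h b by (rule h)
  have "g \<in> admissible p" "h \<in> admissible p"
    using opt area H.admissible_iff by (auto simp: optimal_def)
  then have "measure lborel (region g) = p"
    and "expected_sq_L2_discrepancy g \<le> expected_sq_L2_discrepancy h"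
    using opt G.admissible_iff by (auto simp: optimal_def)
  note a = this
  have "0 \<le> p * (1 - p) * (expected_sq_L2_discrepancy h - expected_sq_L2_discrepancy g)"
    using p a by simp
  also note expected_variation_le[OF p G.region_borel a(1) H.region_borel area]
  also note variation_kernel_integral[OF p G.region_borel a(1) H.region_borel area
      G.variation_density_continuous]
  finally show ?thesis .
qed

text \<open>The corner area with \<open>y = 1\<close> is the integral of \<open>g\<close> over
  \<open>{0..t}\<close>. It does not see null sets, and by continuity of \<open>g\<close> its
  derivative at \<open>x\<close> is \<open>g x\<close>.\<close>

lemma region_determines_curve:
  assumes g: "symmetric_curve g a" and h: "symmetric_curve h b"
    and ae: "AE u in USQ. u \<in> region h \<longleftrightarrow> u \<in> region g" and x: "0 < x" "x < 1"
  shows "h x = g x"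
proof -
  have d: "((\<lambda>t. corner_area g t 1) has_real_derivative g x) (at x)" if "symmetric_curve g a" for g a
  proof -
    interpret G: symmetric_curve g a by (rule that)
    have cont: "continuous_on {0..1} (\<lambda>s. min 1 (g s))" by (rule G.min_g_continuous) simp_all
    have "((\<lambda>t. integral {0..t} (\<lambda>s. min 1 (g s))) has_real_derivative min 1 (g x)) (at x within {0..1})"
      using x by (intro integral_has_real_derivative cont) simp
    then have "((\<lambda>t. corner_area g t 1) has_real_derivative min 1 (g x)) (at x within {0..1})"
      unfolding has_field_derivative_def
      by (rule has_derivative_transform[rotated 2]) (use x in \<open>simp_all add: G.corner_area_eq_integral\<close>)
    moreover have "min 1 (g x) = g x" using G.g_range(2)[of x] G.a_le_1 x by simp
    ultimately show ?thesis using x by (simp add: at_within_Icc_at)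
  qed
  interpret G: symmetric_curve g a by (rule g)
  interpret H: symmetric_curve h b by (rule h)
  have "corner_area h t 1 = corner_area g t 1" for t
    unfolding corner_area_eq_expectation[OF G.region_borel] corner_area_eq_expectation[OF H.region_borel]
  proof (rule integral_cong_AE)
    show "AE u in USQ. indicator (region h) u * corner_event (t, 1) u = indicator (region g) u * corner_event (t, 1) u"
      using ae by eventually_elim (simp add: indicator_def)
  qed measurable
  then show ?thesis using DERIV_unique[OF d[OF h]] d[OF g] by simp
qed

text \<open>A strict inequality would leave room for a level \<open>\<kappa>\<close> and a
  competitor of equal area, raised near \<open>x1\<close>, where the kernel is below
  \<open>\<kappa>\<close>, and lowered near \<open>x2\<close>, where it is above. This strictly
  decreases the integral of the kernel unless the two regions agree almost everywhere, and agreement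
  fails at \<open>x1\<close>.\<close>

lemma optimal_kernel_not_less:
  assumes p: "0 < p" "p < 1" and opt: "optimal p g" and g: "symmetric_curve g a"
    and c: "0 < c" "c < a" "g c = c"
    and x: "0 < x1" "x1 < c" "0 < x2" "x2 < c"
  shows "\<not> variation_kernel p g x1 (g x1) < variation_kernel p g x2 (g x2)"
proof
  let ?K = "variation_kernel p g"
  assume "?K x1 (g x1) < ?K x2 (g x2)"
  then obtain \<kappa> where \<kappa>: "?K x1 (g x1) < \<kappa>" "\<kappa> < ?K x2 (g x2)" using dense by blast
  interpret G: symmetric_curve g a by (rule g)
  have c1: "c \<le> 1" using c G.a_le_1 by simp
  obtain l1 r1 where b1: "0 < l1" "l1 < x1" "x1 < r1" "r1 < c"
    and K1: "\<And>x y. x \<in> {l1..r1} \<Longrightarrow> y \<in> {l1..r1} \<Longrightarrow> ?K x (g y) < \<kappa>"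
    using less_on_box[OF G.variation_kernel_continuous' x(1,2) c1, of p \<kappa>] \<kappa> by auto
  have "continuous_on ({0..1} \<times> {0..1}) (\<lambda>z. - (\<lambda>(x, y). ?K x (g y)) z)"
    by (intro continuous_on_minus G.variation_kernel_continuous')
  from less_on_box[OF this x(3,4) c1, of "- \<kappa>"]
  obtain l2 r2 where b2: "0 < l2" "l2 < x2" "x2 < r2" "r2 < c"
    and K2: "\<And>x y. x \<in> {l2..r2} \<Longrightarrow> y \<in> {l2..r2} \<Longrightarrow> \<kappa> < ?K x (g y)"
    using \<kappa> by auto
  \<comment> \<open>Arguments are pulled to the left near \<open>x1\<close> and pushed to the right
    near \<open>x2\<close>; since \<open>g\<close> decreases, \<open>\<psi>1\<close> raises the
    curve and \<open>\<psi>2\<close> lowers it.\<close>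
  define \<psi>1 where "\<psi>1 x = x + (- 1 / 2) * bump l1 r1 x" for x
  define \<psi>2 where "\<psi>2 x = x + (1 / 2) * bump l2 r2 x" for x
  have strict: "x < y \<Longrightarrow> \<psi>1 x < \<psi>1 y" "x < y \<Longrightarrow> \<psi>2 x < \<psi>2 y" for x y
    unfolding \<psi>1_def \<psi>2_def using b1 b2 c1 by (intro bump_shift_strict_mono; simp)+
  then have mono: "x \<le> y \<Longrightarrow> \<psi>1 x \<le> \<psi>1 y" "x \<le> y \<Longrightarrow> \<psi>2 x \<le> \<psi>2 y" for x y
    by (metis less_eq_real_def)+
  have out: "x \<notin> {l1<..<r1} \<Longrightarrow> \<psi>1 x = x" "x \<notin> {l2<..<r2} \<Longrightarrow> \<psi>2 x = x" for x
    unfolding \<psi>1_def \<psi>2_def using b1 b2 bump_zero[of l1 r1 x] bump_zero[of l2 r2 x] by simp_all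
  have le: "\<psi>1 x \<le> x" "x \<le> \<psi>2 x" for x
    unfolding \<psi>1_def \<psi>2_def using b1 b2 bump_nonneg[of l1 r1 x] bump_nonneg[of l2 r2 x] by simp_all
  have less: "x \<in> {l1<..<r1} \<Longrightarrow> \<psi>1 x < x" "x \<in> {l2<..<r2} \<Longrightarrow> x < \<psi>2 x" for x
    unfolding \<psi>1_def \<psi>2_def using bump_pos[of l1 x r1] bump_pos[of l2 x r2] by simp_all
  have ends: "\<psi>1 0 = 0" "\<psi>1 c = c" "\<psi>2 0 = 0" "\<psi>2 c = c" "\<psi>1 l1 = l1" "\<psi>2 r2 = r2"
    using b1 b2 by (intro out; simp)+
  have mem: "\<psi>1 x \<in> {0..c}" "\<psi>2 x \<in> {0..c}" if "x \<in> {0..c}" for x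
    using that mono(1)[of 0 x] mono(1)[of x c] mono(2)[of 0 x] mono(2)[of x c] by (simp_all add: ends)
  have cont_g: "continuous_on {0..c} g"
    using c1 by (intro continuous_on_subset[OF G.g_continuous]) simp
  have cont: "continuous_on {0..c} (\<lambda>x. g (\<psi>1 x))" "continuous_on {0..c} (\<lambda>x. g (\<psi>2 x))"
  proof -
    have "continuous_on {0..c} \<psi>1" "continuous_on {0..c} \<psi>2"
      unfolding \<psi>1_def \<psi>2_def by (intro continuous_intros bump_continuous)+
    then show "continuous_on {0..c} (\<lambda>x. g (\<psi>1 x))" "continuous_on {0..c} (\<lambda>x. g (\<psi>2 x))"
      by (auto intro!: continuous_on_compose2[OF cont_g] simp del: atLeastAtMost_iff dest: mem)
  qed
  have g_le: "g y \<le> g x" if "0 \<le> x" "x \<le> y" "y \<le> c" for x y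
    using that c1 by (intro G.g_antimono) simp_all
  have g_less: "g y < g x" if "0 \<le> x" "x < y" "y \<le> c" for x y
    using that c by (intro G.g_strict) simp_all
  have gle: "g x \<le> g (\<psi>1 x)" "g (\<psi>2 x) \<le> g x" if "x \<in> {0..c}" for x
    using mem[OF that] le[of x] that by (auto intro!: g_le)
  define m1 m2 where "m1 = integral {0..c} (\<lambda>x. g (\<psi>1 x) - g x)"
    and "m2 = integral {0..c} (\<lambda>x. g x - g (\<psi>2 x))"
  have m: "0 < m1" "0 < m2"
  proof -
    have "g x1 < g (\<psi>1 x1)" "g (\<psi>2 x2) < g x2"
      using less(1)[of x1] less(2)[of x2] mem[of x1] mem[of x2] b1 b2 x by (auto intro!: g_less)
    moreover have "continuous_on {0..c} (\<lambda>x. g (\<psi>1 x) - g x)" "continuous_on {0..c} (\<lambda>x. g x - g (\<psi>2 x))"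
      by (intro continuous_intros cont cont_g)+
    ultimately show "0 < m1" "0 < m2"
      unfolding m1_def m2_def using c x gle
      by (auto intro: integral_pos_of_pos_at[where x=x1] integral_pos_of_pos_at[where x=x2])
  qed
  \<comment> \<open>\<open>m1\<close> is the area gained under \<open>\<psi>1\<close> and
    \<open>m2\<close> the area lost under \<open>\<psi>2\<close>. The weights make gain and loss
    cancel; as they sum to 1, the combination keeps the end values \<open>a\<close> and
    \<open>c\<close> and stays between the two extreme curves.\<close>
  define s1 s2 where "s1 = m2 / (m1 + m2)" and "s2 = m1 / (m1 + m2)"
  have s: "0 < s1" "0 < s2" "s1 + s2 = 1" "s1 * m1 = s2 * m2"
    using m by (simp_all add: s1_def s2_def flip: add_divide_distrib)
  define f where "f x = s1 * g (\<psi>1 x) + s2 * g (\<psi>2 x)" for x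
  have cont_f: "continuous_on {0..c} f"
    unfolding f_def by (intro continuous_intros cont)
  have f_bounds: "f x \<le> g (\<psi>1 x)" "g (\<psi>2 x) \<le> f x" if "x \<in> {0..c}" for x
  proof -
    have "s2 * g (\<psi>2 x) \<le> s2 * g (\<psi>1 x)" "s1 * g (\<psi>2 x) \<le> s1 * g (\<psi>1 x)"
      using s gle[OF that] by (auto intro!: mult_left_mono)
    moreover have "t = s1 * t + s2 * t" for t using s(3) by (simp flip: distrib_right)
    ultimately show "f x \<le> g (\<psi>1 x)" "g (\<psi>2 x) \<le> f x" unfolding f_def by (metis add_left_mono, metis add_right_mono)
  qed
  interpret F: upper_half f c a
  proof
    show "f 0 = a" "f c = c"
      using s(3) by (simp_all add: f_def ends G.g_0 c flip: distrib_right)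
    fix x y :: real assume xy: "0 \<le> x" "x < y" "y \<le> c"
    then have "g (\<psi>1 y) < g (\<psi>1 x)" "g (\<psi>2 y) < g (\<psi>2 x)"
      using strict[of x y] mem[of x] mem[of y] by (auto intro!: g_less)
    then show "f y < f x" using s unfolding f_def by (intro add_strict_mono mult_strict_left_mono)
  qed (use c G.a_le_1 cont_f in simp_all)
  interpret H: symmetric_curve F.h a by (rule F.symmetric_curve_h)
  have area_g: "measure lborel (region g) = p"
    using opt G.admissible_iff by (auto simp: optimal_def)
  have "integral {0..c} f = integral {0..c} (\<lambda>x. g x + (s1 * (g (\<psi>1 x) - g x) - s2 * (g x - g (\<psi>2 x))))"
  proof (rule Henstock_Kurzweil_Integration.integral_cong)
    fix x
    have "g x = s1 * g x + s2 * g x" using s(3) by (simp flip: distrib_right)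
    then show "f x = g x + (s1 * (g (\<psi>1 x) - g x) - s2 * (g x - g (\<psi>2 x)))"
      by (simp add: f_def algebra_simps)
  qed
  also have "\<dots> = integral {0..c} g + (s1 * m1 - s2 * m2)"
    unfolding m1_def m2_def
    by (subst Henstock_Kurzweil_Integration.integral_add Henstock_Kurzweil_Integration.integral_diff Henstock_Kurzweil_Integration.integral_mult_right;
        auto intro!: integrable_continuous_real continuous_intros cont cont_g)+
  finally have "integral {0..c} f = integral {0..c} g" using s by simp
  moreover have "integral {0..c} F.h = integral {0..c} f"
    by (intro Henstock_Kurzweil_Integration.integral_cong F.h_lower)
  moreover have "F.h c = c" using c F.f_c F.h_lower[of c] by simp
  ultimately have area_h: "measure lborel (region F.h) = p"
    using G.measure_region_fixed_point[OF c] H.measure_region_fixed_point[OF c(1,2)] area_g by simp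
  let ?i = "\<lambda>u. indicator (region F.h) u - indicator (region g) u :: real"
  let ?k = "\<lambda>u. ?K (fst u) (snd u)"
  text \<open>Only the part with \<open>x \<le> c\<close> has to be examined: the remaining part is its mirror image, and the
    kernel is symmetric.\<close>
  have above: "?K x y < \<kappa>" if "0 < x" "x \<le> c" "0 < y" "y \<le> F.h x" "\<not> y \<le> g x" for x y
  proof -
    have x': "x \<in> {0..c}" using that by simp
    have y: "g x < y" "y \<le> g (\<psi>1 x)" using that f_bounds(1)[OF x'] F.h_lower[OF x'] by simp_all
    then have xin: "x \<in> {l1<..<r1}" using out(1)[of x] by fastforce
    have y_a: "y \<in> {0..a}" using y that G.g_mem[of "\<psi>1 x"] mem(1)[OF x'] c by auto
    \<comment> \<open>Applying \<open>g\<close> to \<open>g x < y\<close> and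
      \<open>y \<le> g (\<psi>1 x)\<close> places \<open>g y\<close> in the interval around
      \<open>x1\<close>; the point is then \<open>(x, g (g y))\<close>, to which \<open>K1\<close>
      applies.\<close>
    have "\<psi>1 x \<le> g y" "g y \<le> x"
    proof -
      have "g (g (\<psi>1 x)) \<le> g y"
        using y y_a G.a_le_1 G.g_mem[of "\<psi>1 x"] mem(1)[OF x'] c by (intro G.g_antimono) auto
      then show "\<psi>1 x \<le> g y" using G.g_g[of "\<psi>1 x"] mem(1)[OF x'] c by simp
      have "g y \<le> g (g x)"
        using y y_a G.a_le_1 G.g_mem[of x] x' c by (intro G.g_antimono) auto
      then show "g y \<le> x" using G.g_g[of x] x' c by simp
    qed
    moreover have "l1 \<le> \<psi>1 x" using mono(1)[of l1 x] xin ends by simp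
    ultimately have "g y \<in> {l1..r1}" using xin by simp
    then have "?K x (g (g y)) < \<kappa>" using K1 xin by simp
    then show ?thesis using G.g_g[OF y_a] by simp
  qed
  have below: "\<kappa> < ?K x y" if "0 < x" "x \<le> c" "0 < y" "\<not> y \<le> F.h x" "y \<le> g x" for x y
  proof -
    have x': "x \<in> {0..c}" using that by simp
    have y: "g (\<psi>2 x) \<le> y" "y \<le> g x" "g (\<psi>2 x) < g x"
      using that f_bounds(2)[OF x'] F.h_lower[OF x'] by simp_all
    then have xin: "x \<in> {l2<..<r2}" using out(2)[of x] by fastforce
    have y_a: "y \<in> {0..a}" using y that G.g_mem[of x] x' c by auto
    have "x \<le> g y" "g y \<le> \<psi>2 x"
    proof -
      have "g (g x) \<le> g y"
        using y y_a G.a_le_1 G.g_mem[of x] x' c by (intro G.g_antimono) auto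
      then show "x \<le> g y" using G.g_g[of x] x' c by simp
      have "g y \<le> g (g (\<psi>2 x))"
        using y y_a G.a_le_1 G.g_mem[of "\<psi>2 x"] mem(2)[OF x'] c by (intro G.g_antimono) auto
      then show "g y \<le> \<psi>2 x" using G.g_g[of "\<psi>2 x"] mem(2)[OF x'] c by simp
    qed
    moreover have "\<psi>2 x \<le> r2" using mono(2)[of x r2] xin ends by simp
    ultimately have "g y \<in> {l2..r2}" using xin by simp
    then have "\<kappa> < ?K x (g (g y))" using K2 xin by simp
    then show ?thesis using G.g_g[OF y_a] by simp
  qed
  have pos: "AE u in USQ. 0 < fst u \<and> 0 < snd u \<and> fst u \<le> 1 \<and> snd u \<le> 1"
    unfolding unit_square_measure_def
  proof (rule AE_uniform_measureI)
    show "AE u in lborel. u \<in> unit_square \<longrightarrow> 0 < fst u \<and> 0 < snd u \<and> fst u \<le> 1 \<and> snd u \<le> 1"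
      using AE_lborel_coordinates_nonzero
      by eventually_elim (simp add: unit_square_def mem_Times_iff less_le)
  qed simp
  \<comment> \<open>Where the regions differ, \<open>?i u * (?k u - \<kappa>)\<close> is strictly
    negative, so a vanishing integral forces them to agree almost everywhere.\<close>
  have sign: "AE u in USQ. 0 \<le> - (?i u * (?k u - \<kappa>)) \<and> (?i u \<noteq> 0 \<longrightarrow> ?i u * (?k u - \<kappa>) \<noteq> 0)"
    using pos
  proof eventually_elim
    case (elim u)
    obtain x y where u: "u = (x, y)" by (cases u)
    have xy: "0 < x" "x \<le> 1" "0 < y" "y \<le> 1" using elim by (simp_all add: u)
    have reg: "u \<in> region F.h \<longleftrightarrow> y \<le> F.h x" "u \<in> region g \<longleftrightarrow> y \<le> g x"
      using xy by (simp_all add: u region_def unit_square_def)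
    have K: "(y \<le> F.h x \<and> \<not> y \<le> g x \<longrightarrow> ?K x y < \<kappa>) \<and> (\<not> y \<le> F.h x \<and> y \<le> g x \<longrightarrow> \<kappa> < ?K x y)"
    proof (cases "x \<le> c")
      case True
      then show ?thesis using above[of x y] below[of x y] xy by blast
    next
      case False
      have sw: "y \<le> F.h x \<longleftrightarrow> x \<le> F.h y" "y \<le> g x \<longleftrightarrow> x \<le> g y" "?K x y = ?K y x"
        using xy H.le_g_iff[of x y] G.le_g_iff[of x y] G.variation_kernel_commute[of x y p]
        by simp_all
      \<comment> \<open>To the right of \<open>c\<close> both curves are below \<open>c\<close>, so
        the mirrored point has its first coordinate in \<open>{0..c}\<close>.\<close>
      have "y \<le> c" if "y \<le> F.h x \<or> y \<le> g x"
      proof -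
        have "F.h x \<le> F.h c" "g x \<le> g c"
          using H.g_antimono[of c x] G.g_antimono[of c x] False c xy by simp_all
        then show ?thesis using that c \<open>F.h c = c\<close> by auto
      qed
      then show ?thesis using above[of y x] below[of y x] xy unfolding sw by blast
    qed
    have "(u \<in> region F.h \<and> u \<notin> region g \<longrightarrow> ?k u < \<kappa>) \<and> (u \<notin> region F.h \<and> u \<in> region g \<longrightarrow> \<kappa> < ?k u)"
      using K unfolding reg by (simp add: u)
    then show ?case by (auto simp: indicator_def)
  qed
  have sub: "region F.h \<subseteq> unit_square" "region g \<subseteq> unit_square" by (auto simp: region_def)
  have kint: "integrable USQ (\<lambda>u. ?i u * ?k u)"
    unfolding left_diff_distrib
    by (intro Bochner_Integration.integrable_diff G.variation_kernel_integrable sub G.region_borel H.region_borel)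
  have ind: "integrable USQ (\<lambda>u. indicator A u :: real)" if "A \<in> sets borel" for A
    using that
    by (intro USQ.integrable_const_bound[where B=1] borel_measurable_indicator)
      (simp_all add: indicator_def)
  have iint: "integrable USQ ?i"
    by (intro Bochner_Integration.integrable_diff ind G.region_borel H.region_borel)
  have "integral\<^sup>L USQ ?i = measure USQ (region F.h) - measure USQ (region g)"
    using ind[OF G.region_borel] ind[OF H.region_borel] by simp
  also have "\<dots> = 0"
    using sub area_g area_h by (simp add: USQ_measure)
  finally have "integral\<^sup>L USQ ?i = 0" .
  \<comment> \<open>The equality of areas lets the constant \<open>\<kappa>\<close> be subtracted
    without changing the first variation.\<close>
  then have "(LINT u|USQ. - (?i u * (?k u - \<kappa>))) = - (LINT u|USQ. ?i u * ?k u)"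
    using kint iint by (simp add: right_diff_distrib)
  also have "\<dots> \<le> 0" using optimal_first_variation[OF p opt g H.symmetric_curve_axioms area_h] by simp
  finally have "(LINT u|USQ. - (?i u * (?k u - \<kappa>))) \<le> 0" .
  moreover have "0 \<le> (LINT u|USQ. - (?i u * (?k u - \<kappa>)))"
    using sign by (intro integral_nonneg_AE) auto
  ultimately have "(LINT u|USQ. - (?i u * (?k u - \<kappa>))) = 0" by simp
  moreover have "integrable USQ (\<lambda>u. - (?i u * (?k u - \<kappa>)))"
    using kint iint by (simp add: right_diff_distrib)
  ultimately have "AE u in USQ. - (?i u * (?k u - \<kappa>)) = 0"
    using sign by (subst (asm) integral_nonneg_eq_0_iff_AE) auto
  then have "AE u in USQ. u \<in> region F.h \<longleftrightarrow> u \<in> region g"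
    using sign by eventually_elim (auto simp: indicator_def split: if_splits)
  then have "F.h x1 = g x1"
    using x c1 by (intro region_determines_curve[OF g H.symmetric_curve_axioms]) simp_all
  then have "f x1 = g x1" using F.h_lower[of x1] x by simp
  \<comment> \<open>The kernel at \<open>x1\<close> cannot be both below and above
    \<open>\<kappa>\<close>. Hence \<open>\<psi>2\<close> fixes \<open>x1\<close>, the curve is not
    lowered there, and raising it with the positive weight \<open>s1\<close> gives
    \<open>f x1 > g x1\<close>.\<close>
  have "x1 \<notin> {l2<..<r2}" using K1[of x1 x1] K2[of x1 x1] b1 by force
  then have "f x1 = s1 * g (\<psi>1 x1) + s2 * g x1" using out(2) by (simp add: f_def)
  moreover have "g x1 < g (\<psi>1 x1)"
    using less(1)[of x1] mem[of x1] b1 x by (auto intro!: g_less)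
  then have "s1 * g x1 < s1 * g (\<psi>1 x1)" using s by simp
  moreover have "g x1 = s1 * g x1 + s2 * g x1" using s(3) by (simp flip: distrib_right)
  ultimately show False using \<open>f x1 = g x1\<close> by linarith
qed

text \<open>The comparison works strictly between \<open>0\<close> and \<open>c\<close> only.
  Continuity adds the two ends, and the reflection \<open>x\<close> to \<open>g x\<close>, under
  which the kernel is symmetric, carries the constant over to the other half.\<close>

lemma optimal_kernel_constant:
  assumes p: "0 < p" "p < 1" and opt: "optimal p g" and g: "symmetric_curve g a"
  obtains \<kappa> where "\<And>x. x \<in> {0..a} \<Longrightarrow> variation_kernel p g x (g x) = \<kappa>"
proof -
  interpret symmetric_curve g a by (rule g)
  let ?k = "\<lambda>x. variation_kernel p g x (g x)"
  obtain c where c: "0 < c" "c < a" "g c = c" by (rule fixed_point)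
  have inner: "?k x = ?k (c / 2)" if "x \<in> {0<..<c}" for x
    using optimal_kernel_not_less[OF p opt g c, of x "c / 2"]
      optimal_kernel_not_less[OF p opt g c, of "c / 2" x] that c by (simp add: not_less)
  have cont: "continuous_on {0..c} ?k"
  proof -
    have diag: "continuous_on {0..c} (\<lambda>x. (x, x))" by (intro continuous_intros)
    have "(\<lambda>x. (x, x)) ` {0..c} \<subseteq> {0..1} \<times> {0..1}" using c(2) a_le_1 by auto
    from continuous_on_compose2[OF variation_kernel_continuous' diag this] show ?thesis by simp
  qed
  have lower: "?k x = ?k (c / 2)" if "x \<in> {0..c}" for x
  proof (rule continuous_constant_on_closure[where S="{0<..<c}" and f="?k"])
    show "continuous_on (closure {0<..<c}) ?k" using cont c(1) by (simp only: closure_greaterThanLessThan)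
    show "x \<in> closure {0<..<c}" using that c(1) by (simp only: closure_greaterThanLessThan)
  qed (rule inner)
  show thesis
  proof (rule that)
    fix x assume x: "x \<in> {0..a}"
    show "?k x = ?k (c / 2)"
    proof (cases "x \<le> c")
      case True
      then show ?thesis using x by (intro lower) simp
    next
      case False
      have gx: "g x \<in> {0..a}" "g (g x) = x" using g_mem[OF x] g_g[OF x] by simp_all
      have "g x \<le> g c" using False c x a_le_1 by (intro g_antimono) simp_all
      then have "?k (g x) = ?k (c / 2)" using gx c by (intro lower) simp
      moreover have "?k (g x) = ?k x"
        unfolding gx(2) using x gx(1) a_le_1 by (intro variation_kernel_commute) simp_all
      ultimately show ?thesis by simp
    qed
  qed
qed

section \<open>The derivative of the kernel along the curve\<close>

lemma (in symmetric_curve) integral_variation_density: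
  assumes "u \<in> {0..a}"
  shows "4 * integral {g u..1} (\<lambda>y. variation_density p g (u, y)) =
     (1 - 2 * p - 4 * u * g u) * (1 - g u) + (4 * p - 1) * u * (1 - (g u)\<^sup>2)
     - 4 * integral {g u..a} (\<lambda>y. (1 - y) * g y)"
proof -
  let ?v = "g u"
  have v: "0 \<le> ?v" "?v \<le> 1" "u \<le> 1" using g_mem[OF assms] a_le_1 assms by simp_all
  have c: "continuous_on {?v..1} (corner_area g u)"
  proof -
    have pair: "continuous_on {?v..1} (\<lambda>y. (u, y))" by (intro continuous_intros)
    have "(\<lambda>y. (u, y)) ` {?v..1} \<subseteq> unit_square" using assms v by (auto simp: unit_square_def)
    from continuous_on_compose2[OF corner_area_continuous pair this] show ?thesis by simp
  qed
  have "((\<lambda>y. (1 - 2 * p) / 4 * y + (2 * p - 1 / 2) * u * (y\<^sup>2 / 2)) has_real_derivative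
      (1 - 2 * p) / 4 + (2 * p - 1 / 2) * (u * y)) (at y within {?v..1})" for y
    by (auto intro!: derivative_eq_intros)
  then have "((\<lambda>y. (1 - 2 * p) / 4 + (2 * p - 1 / 2) * (u * y)) has_integral
      ((1 - 2 * p) / 4 * 1 + (2 * p - 1 / 2) * u * (1\<^sup>2 / 2)
        - ((1 - 2 * p) / 4 * ?v + (2 * p - 1 / 2) * u * (?v\<^sup>2 / 2)))) {?v..1}"
    using v by (intro fundamental_theorem_of_calculus)
      (simp_all add: has_real_derivative_iff_has_vector_derivative)
  from has_integral_diff[OF this integrable_integral[OF integrable_continuous_real[OF c]]]
  have "integral {?v..1} (\<lambda>y. variation_density p g (u, y)) =
      (1 - 2 * p) / 4 * 1 + (2 * p - 1 / 2) * u * (1\<^sup>2 / 2)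
        - ((1 - 2 * p) / 4 * ?v + (2 * p - 1 / 2) * u * (?v\<^sup>2 / 2))
        - integral {?v..1} (corner_area g u)"
    by (intro integral_unique) (simp add: variation_density_def)
  \<comment> \<open>The factor 4 clears the denominator of \<open>(1 - 2 * p) / 4\<close> and turns
    the halved coefficient \<open>2 * p - 1 / 2\<close> into \<open>4 * p - 1\<close>.\<close>
  then show ?thesis
    unfolding integral_corner_area[OF assms] by (simp add: field_simps power2_eq_square)
qed

theorem mainTheorem1:
  fixes p a x g' :: real and g :: "real \<Rightarrow> real"
  assumes "0 < p" and "p < 1"
    and "optimal p g"
    and "symmetric_graph g a"
    and "0 \<le> x" and "x \<le> a"
    and "(g has_real_derivative g') (at x within {0..1})"
  shows "(1 - 2 * p - 4 * x * g x) * (1 - g x) + (4 * p - 1) * x * (1 - (g x)\<^sup>2)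
           - 4 * integral {g x..a} (\<lambda>y. (1 - y) * g y)
         + g' * ((1 - 2 * p - 4 * x * g x) * (1 - x) + (4 * p - 1) * g x * (1 - x\<^sup>2)
                 - 4 * integral {x..a} (\<lambda>y. (1 - y) * g y)) = 0"
proof -
  have curve: "symmetric_curve g a"
    using assms(3,4) by (simp add: symmetric_curve_def optimal_def admissible_def)
  interpret symmetric_curve g a by (rule curve)
  let ?B = "variation_density p g" and ?K = "\<lambda>(u, v). variation_kernel p g u v"
  have x: "x \<in> {0..a}" using assms(5,6) by simp
  note gx = g_mem[OF x] g_g[OF x]
  obtain \<kappa> where \<kappa>: "\<And>x. x \<in> {0..a} \<Longrightarrow> variation_kernel p g x (g x) = \<kappa>"
    using optimal_kernel_constant[OF assms(1-3) curve] by blast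
  define D1 D2 where "D1 = integral {g x..1} (\<lambda>y. ?B (x, y))"
    and "D2 = integral {x..1} (\<lambda>s. ?B (s, g x))"
  \<comment> \<open>Constancy of the kernel is known on \<open>{0..a}\<close>, so the derivative is
    restricted to this interval; it becomes one-sided at the ends.\<close>
  have "(g has_derivative (\<lambda>t. g' * t)) (at x within {0..a})"
    by (rule has_derivative_subset[OF assms(7)[unfolded has_field_derivative_def]])
      (use a_le_1 in simp)
  then have curve': "((\<lambda>t. (t, g t)) has_derivative (\<lambda>t. (t, g' * t))) (at x within {0..a})"
    by (intro has_derivative_Pair has_derivative_ident)
  have K: "(?K has_derivative (\<lambda>(s, t). - D1 * s - D2 * t)) (at (x, g x) within {0..1} \<times> {0..1})"
    unfolding D1_def D2_def using x gx a_le_1 by (intro variation_kernel_has_derivative) simp_all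
  have "(\<lambda>t. (t, g t)) ` {0..a} \<subseteq> {0..1} \<times> {0..1}"
    using a_le_1 g_range(1) g_le_1 by auto
  from has_derivative_in_compose[OF curve' has_derivative_subset[OF K this]]
  have "((\<lambda>t. variation_kernel p g t (g t)) has_derivative (\<lambda>t. - D1 * t - D2 * (g' * t))) (at x within {0..a})"
    by simp
  then have "((\<lambda>_. \<kappa>) has_derivative (\<lambda>t. - D1 * t - D2 * (g' * t))) (at x within {0..a})"
    by (rule has_derivative_transform[OF x, rotated]) (simp add: \<kappa>)
  then have "((\<lambda>_. \<kappa>) has_real_derivative (- D1 - D2 * g')) (at x within {0..a})"
    unfolding has_field_derivative_def by (rule has_derivative_eq_rhs) (simp add: fun_eq_iff algebra_simps)
  then have "((\<lambda>_. \<kappa>) has_vector_derivative (- D1 - D2 * g')) (at x within {0..a})"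
    by (simp only: has_real_derivative_iff_has_vector_derivative)
  moreover have "((\<lambda>_. \<kappa>) has_vector_derivative 0) (at x within {0..a})" by simp
  moreover have "at x within {0..a} \<noteq> bot"
    using x a_pos by (simp add: trivial_limit_within)
  ultimately have "- D1 - D2 * g' = 0"
    by (metis vector_derivative_unique_within)
  then have 0: "D1 + g' * D2 = 0" by (simp add: algebra_simps)
  \<comment> \<open>By symmetry of the density, the second partial derivative at
    \<open>(x, g x)\<close> is the first one at the mirrored point, so the same formula applies with
    \<open>g x\<close> in place of \<open>x\<close>.\<close>
  have "D2 = integral {g (g x)..1} (\<lambda>s. ?B (g x, s))"
    unfolding D2_def gx(2)
  proof (rule integral_cong)
    fix s assume "s \<in> {x..1}"
    then show "?B (s, g x) = ?B (g x, s)"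
      using x gx a_le_1 corner_area_commute[of s "g x"]
      by (simp add: variation_density_def mult.commute)
  qed
  with integral_variation_density[OF gx(1), of p]
  have "4 * D2 = (1 - 2 * p - 4 * x * g x) * (1 - x) + (4 * p - 1) * g x * (1 - x\<^sup>2)
      - 4 * integral {x..a} (\<lambda>y. (1 - y) * g y)"
    unfolding gx(2) mult.assoc mult.commute[of "g x" x] by linarith
  moreover note integral_variation_density[OF x, of p, folded D1_def]
  moreover have "4 * D1 + g' * (4 * D2) = 0" using 0 by algebra
  ultimately show ?thesis by simp
qed

end
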